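(* The branch-and-cut algorithm for $(BLF/MOIQP)$ described in the context terminates in a finite number of iterations, and the set $\mathcal{X}_{Eff}$ that it returns contains all the solutions of $(BLF/MOIQP)$ (i.e. all points of $\mathcal{X}_{\mathcal{Q}}\cap\mathcal{X}_{\mathcal{F}}$), if such solutions exist.
   Context: Problem. Let $r\ge 2$, $A\in\mathbb{Z}^{m\times n}$, $b\in\mathbb{Z}^m$, and let $\mathcal{X}=\{x\in\mathbb{R}^n_+ : Ax\le b\}$ be a closed, bounded, non-empty convex polyhedron; put $\mathcal{D}=\mathcal{X}\cap\mathbb{Z}^n$. For $i=1,\dots,r$ let $f_i(x)=\frac12 x^TQ_ix+c_i^Tx$, where $Q_i\in\mathbb{Z}^{n\times n}$ is (symmetric) positive semi-definite and $c_i\in\mathbb{Z}^n$. $(MOIQP)$ is the problem of minimizing $f_1,\dots,f_r$ over $\mathcal{D}$. A point $x^*\in\mathcal{D}$ is efficient for $(MOIQP)$ if there is no $x\in\mathcal{D}$ with $f_i(x)\le f_i(x^* )$ for all $i$ and $f_i(x)<f_i(x^* )$ for at least one $i$; $\mathcal{X}_{\mathcal{Q}}$ denotes the set of efficient points. For $s=1,2$ let $\psi^s(x)=\mathcal{P}^s(x)/\mathcal{Q}^s(x)$ with $\mathcal{P}^s(x)=p^sx+\alpha^s$, $\mathcal{Q}^s(x)=q^sx+\beta^s$, where $p^s,q^s$ are real $n$-vectors and $\alpha^s,\beta^s$ are real constants. $(BOILFP)$ is the problem of minimizing $\psi^1,\psi^2$ over $\mathcal{D}$; its efficient set, defined in the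 same way with $\psi^1,\psi^2$ in place of the $f_i$, is $\mathcal{X}_{\mathcal{F}}$. The problem $(BLF/MOIQP)$ is to optimize $\psi^1,\psi^2$ over $\mathcal{X}_{\mathcal{Q}}$, understood as finding the solutions that are efficient for both $(MOIQP)$ and $(BOILFP)$, i.e. the points of $\mathcal{X}_{\mathcal{Q}}\cap\mathcal{X}_{\mathcal{F}}$. Standing assumptions: $\mathcal{Q}^s(x)>0$ for all $x\in\mathcal{X}$, $s=1,2$; $\psi^s$ is not a strictly positive combination of the linear parts of the quadratic objectives; $\mathcal{X}_{\mathcal{Q}}\ne\mathcal{D}$. Node data. At node $l$ there is a polyhedron $\mathcal{X}_l\subseteq\mathcal{X}$ obtained from $\mathcal{X}$ by adding the branching constraints and cuts accumulated along the path from the root; it is written in equality form with one non-negative slack/surplus variable per constraint. Variables $x_1,\dots,x_n$ are the original ones, those with index larger than $n$ are slack/surplus variables. $(LFP)_l$ is: minimize $\psi^1(x)$ over $x\in\mathcal{X}_l$. If feasible, it is solved by the simplex or dual simplex method, giving an optimal basic solution $x^{*(l)}$ and an optimal tableau with index sets $\mathcal{B}_l$ (basic) and $\mathcal{N}_l$ (non-basic), and $x_k=\hat b_{p(k)}-\sum_{j\in\mathcal{N}_l}\hat a_{p(k)j}x_j$ for $k\in\mathcal{B}_l$, where $p(k)$ is the tableau row of $x_k$. For $j\in\mathcal{N}_l$, $s=1,2$: $\eta^s_j=p^s_j-p^s_{\mathcal{B}_l}\mathcal{B}_l^{-1}a_j$, $\vartheta^s_j=q^s_j-q^s_{\mathcal{B}_l}\mathcal{B}_l^{-1}a_j$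 ($a_j$ the $j$-th column of the constraint matrix of the equality form, $\mathcal{B}_l^{-1}$ the inverse of the basis matrix, cost coefficients of slack/surplus variables equal to $0$), and $\bar\gamma^s_j=\mathcal{Q}^s(x^{*(l)})\eta^s_j-\mathcal{P}^s(x^{*(l)})\vartheta^s_j$; an optimal tableau satisfies $\bar\gamma^1_j\ge0$ for all $j\in\mathcal{N}_l$. With $\nabla f_i(x^{*(l)})=Q_ix^{*(l)}+c_i$, let $\bar f_{i,j}=\rho_{i,j}-\sum_{k\in\mathcal{B}_l\cap\{1,\dots,n\}}\nabla f_i(x^{*(l)})_k\,\hat a_{p(k)j}$ for $j\in\mathcal{N}_l$, where $\rho_{i,j}=\nabla f_i(x^{*(l)})_j$ if $j\le n$ and $\rho_{i,j}=0$ if $j>n$. Define $\mathcal{H}_l=\{j\in\mathcal{N}_l:\exists i\in\{1,\dots,r\},\ \bar f_{i,j}<0\}\cup\{j\in\mathcal{N}_l:\bar f_{i,j}=0\ \forall i\in\{1,\dots,r\}\}$ and $\mathcal{H}'_l=\{j\in\mathcal{N}_l:\bar\gamma^2_j<0\}\cup\{j\in\mathcal{N}_l:\bar\gamma^1_j=0\text{ and }\bar\gamma^2_j=0\}$. Efficiency tests. For integer $x^{*(l)}$, $(\mathcal{T}^1_{x^{*(l)}})$ is: maximize $\sum_{i=1}^r\varepsilon_i$ subject to $f_i(x)+\varepsilon_i\le f_i(x^{*(l)})$, $\varepsilon_i\ge0$ $(i=1,\dots,r)$, $x\in\mathcal{D}$; its optimal value is $0$ iff $x^{*(l)}\in\mathcal{X}_{\mathcal{Q}}$.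 $(\mathcal{T}^2_{x^{*(l)}})$ is: maximize $w_1+w_2$ subject to $(p^s-\psi^s(x^{*(l)})q^s)x+w_s\le\psi^s(x^{*(l)})\beta^s-\alpha^s$, $w_s\ge0$ $(s=1,2)$, $x\in\mathcal{D}$; its optimal value is $0$ iff $x^{*(l)}\in\mathcal{X}_{\mathcal{F}}$. Algorithm. Initialize $\mathcal{X}_{Eff}=\emptyset$, $l=0$, $\mathcal{X}_0=\mathcal{X}$ (one open node). While there is a non-fathomed node $l$: solve $(LFP)_l$. (i) If $(LFP)_l$ is infeasible, fathom node $l$. (ii) If $x^{*(l)}$ is not integer, choose an index $k\le n$ with $x^{*(l)}_k$ fractional and replace node $l$ by two new nodes obtained by adding to $\mathcal{X}_l$ respectively the constraint $x_k\le\lfloor x^{*(l)}_k\rfloor$ and the constraint $x_k\ge\lfloor x^{*(l)}_k\rfloor+1$. (iii) If $x^{*(l)}$ is integer, solve $(\mathcal{T}^1_{x^{*(l)}})$; if its optimal value is $0$, solve $(\mathcal{T}^2_{x^{*(l)}})$; if that optimal value is also $0$, set $\mathcal{X}_{Eff}:=\mathcal{X}_{Eff}\cup\{x^{*(l)}\}$. Then construct $\mathcal{H}_l$ and $\mathcal{H}'_l$. If $\mathcal{H}_l=\emptyset$ or $\mathcal{H}'_l=\emptyset$, fathom node $l$. Otherwise replace node $l$ by a successor node obtained by adding to $\mathcal{X}_l$ both cuts $\sum_{j\in\mathcal{H}_l}x_j\ge1$ and $\sum_{j\in\mathcal{H}'_l}x_j\ge1$. When no open node remains, return $\mathcal{X}_{Eff}$.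 *)

theory Defs
  imports
    "Jordan_Normal_Form.Matrix"
    "Jordan_Normal_Form.Gauss_Jordan_Elimination"
    "HOL-Library.Multiset"
begin

text \<open>Efficient (Pareto-minimal) points of a feasible set \<open>S\<close> for the objectives
  \<open>g i\<close>, \<open>i \<in> I\<close>.\<close>

definition efficient_set :: "'a set \<Rightarrow> nat set \<Rightarrow> (nat \<Rightarrow> 'a \<Rightarrow> real) \<Rightarrow> 'a set" where
  "efficient_set S I g =
    {x \<in> S. \<not> (\<exists>y\<in>S. (\<forall>i\<in>I. g i y \<le> g i x) \<and> (\<exists>i\<in>I. g i y < g i x))}"

definition is_max_value :: "real set \<Rightarrow> real \<Rightarrow> bool" where
  "is_max_value V v \<longleftrightarrow> v \<in> V \<and> (\<forall>w\<in>V. w \<le> v)"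

text \<open>A node is the system \<open>T y = h\<close>, \<open>y \<ge> 0\<close> in equality form. The columns of \<open>T\<close> with index
  \<open>< n\<close> belong to the original variables, and row \<open>i\<close> owns the slack/surplus variable
  with index \<open>n + i\<close>; all indices are 0-based.\<close>

type_synonym node = "real mat \<times> real vec"

text \<open>Append to a node the row \<open>a \<bullet> y + \<sigma> y' = d\<close>, where \<open>y'\<close> is a new last variable
  (slack for \<open>\<sigma> = 1\<close>, surplus for \<open>\<sigma> = -1\<close>). The constraint \<open>a\<close> may involve the
  slack/surplus variables of earlier rows.\<close>

fun add_row :: "node \<Rightarrow> (nat \<Rightarrow> real) \<Rightarrow> real \<Rightarrow> real \<Rightarrow> node" where
  "add_row (T, h) a \<sigma> d =
    (four_block_mat T (0\<^sub>m (dim_row T) 1)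
       (mat 1 (dim_col T) (\<lambda>(_, j). a j)) (mat 1 1 (\<lambda>_. \<sigma>)),
     h @\<^sub>v vec 1 (\<lambda>_. d))"

definition add_le :: "node \<Rightarrow> (nat \<Rightarrow> real) \<Rightarrow> real \<Rightarrow> node" where
  "add_le N a d = add_row N a 1 d"

definition add_ge :: "node \<Rightarrow> (nat \<Rightarrow> real) \<Rightarrow> real \<Rightarrow> node" where
  "add_ge N a d = add_row N a (-1) d"

definition ext_points :: "node \<Rightarrow> real vec set" where
  "ext_points N =
    {y \<in> carrier_vec (dim_col (fst N)). 0\<^sub>v (dim_col (fst N)) \<le> y \<and> fst N *\<^sub>v y = snd N}"

lemma ext_points_add_row:
  assumes "T \<in> carrier_mat M N" "h \<in> carrier_vec M" "y \<in> carrier_vec N"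
  shows "y @\<^sub>v vec 1 (\<lambda>_. z) \<in> ext_points (add_row (T, h) a \<sigma> d) \<longleftrightarrow>
    y \<in> ext_points (T, h) \<and> z \<ge> 0 \<and> (\<Sum>j<N. a j * y $ j) + \<sigma> * z = d"
proof -
  let ?z = "vec 1 (\<lambda>_. z)"
  have 1: "four_block_mat T (0\<^sub>m M 1) (mat 1 N (\<lambda>(_, j). a j)) (mat 1 1 (\<lambda>_. \<sigma>)) *\<^sub>v (y @\<^sub>v ?z)
    = (T *\<^sub>v y + 0\<^sub>m M 1 *\<^sub>v ?z) @\<^sub>v (mat 1 N (\<lambda>(_, j). a j) *\<^sub>v y + mat 1 1 (\<lambda>_. \<sigma>) *\<^sub>v ?z)"
    by (rule four_block_mat_mult_vec) (use assms in auto)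
  have 2: "mat 1 N (\<lambda>(_, j). a j) *\<^sub>v y + mat 1 1 (\<lambda>_. \<sigma>) *\<^sub>v ?z =
    vec 1 (\<lambda>_. (\<Sum>j<N. a j * y $ j) + \<sigma> * z)"
    using assms by (auto simp: scalar_prod_def lessThan_atLeast0)
  have 3: "T *\<^sub>v y + 0\<^sub>m M 1 *\<^sub>v ?z = T *\<^sub>v y"
    using assms by (auto simp: scalar_prod_def)
  have 4: "T *\<^sub>v y @\<^sub>v vec 1 (\<lambda>_. (\<Sum>j<N. a j * y $ j) + \<sigma> * z) = h @\<^sub>v vec 1 (\<lambda>_. d) \<longleftrightarrow>
     T *\<^sub>v y = h \<and> (\<Sum>j<N. a j * y $ j) + \<sigma> * z = d"
    using assms by (subst append_vec_eq[of _ M]) (auto simp: vec_eq_iff)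
  have 5: "0\<^sub>v (Suc N) \<le> y @\<^sub>v ?z \<longleftrightarrow> 0\<^sub>v N \<le> y \<and> z \<ge> 0"
    using assms by (auto simp: less_eq_vec_def less_Suc_eq)
  show ?thesis
  proof -
    have row: "fst (add_row (T, h) a \<sigma> d) =
        four_block_mat T (0\<^sub>m M 1) (mat 1 N (\<lambda>(_, j). a j)) (mat 1 1 (\<lambda>_. \<sigma>))"
      and rhs: "snd (add_row (T, h) a \<sigma> d) = h @\<^sub>v vec 1 (\<lambda>_. d)"
      and col: "dim_col (fst (add_row (T, h) a \<sigma> d)) = Suc N" "dim_col T = N"
      using assms by auto
    have car: "y @\<^sub>v ?z \<in> carrier_vec (Suc N)"
      using append_carrier_vec[OF assms(3), of ?z 1] by simp
    show ?thesis
      unfolding ext_points_def mem_Collect_eq col rhs fst_conv snd_conv 5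
      unfolding row 1 2 3 4 using car assms(3) by blast
  qed
qed

text \<open>A basis is the list \<open>bs\<close> of its variables, ordered by tableau row. Then \<open>row_of bs k\<close> is
  the tableau row \<open>p(k)\<close> of the basic variable \<open>k\<close>.\<close>

definition basis_mat :: "real mat \<Rightarrow> nat list \<Rightarrow> real mat" where
  "basis_mat T bs = mat_of_cols (dim_row T) (map (col T) bs)"

definition is_basis :: "real mat \<Rightarrow> nat list \<Rightarrow> bool" where
  "is_basis T bs \<longleftrightarrow> distinct bs \<and> set bs \<subseteq> {..<dim_col T} \<and> length bs = dim_row T
     \<and> invertible_mat (basis_mat T bs)"

definition nonbasic :: "real mat \<Rightarrow> nat list \<Rightarrow> nat set" where
  "nonbasic T bs = {..<dim_col T} - set bs"

definition row_of :: "nat list \<Rightarrow> nat \<Rightarrow> nat" where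
  "row_of bs k = (THE i. i < length bs \<and> bs ! i = k)"

definition basis_inv :: "real mat \<Rightarrow> nat list \<Rightarrow> real mat" where
  "basis_inv T bs = the (mat_inverse (basis_mat T bs))"

definition a_hat :: "real mat \<Rightarrow> nat list \<Rightarrow> real mat" where
  "a_hat T bs = basis_inv T bs * T"

definition b_hat :: "node \<Rightarrow> nat list \<Rightarrow> real vec" where
  "b_hat N bs = basis_inv (fst N) bs *\<^sub>v snd N"

definition basic_sol :: "node \<Rightarrow> nat list \<Rightarrow> real vec" where
  "basic_sol N bs =
    vec (dim_col (fst N)) (\<lambda>k. if k \<in> set bs then b_hat N bs $ row_of bs k else 0)"

text \<open>The problem data. The locale carries no assumptions, which are collected in
  \<open>blf_moiqp\<close> below. The objectives of the quadratic problem are indexed by \<open>1..r\<close>, those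
  of the fractional problem by \<open>1, 2\<close>.\<close>

locale blf_data =
  fixes n m r :: nat
    and A :: "int mat" and b :: "int vec"
    and Q :: "nat \<Rightarrow> int mat" and c :: "nat \<Rightarrow> int vec"
    and p q :: "nat \<Rightarrow> real vec" and \<alpha> \<beta> :: "nat \<Rightarrow> real"
begin

definition X :: "real vec set" where
  "X = {x \<in> carrier_vec n. 0\<^sub>v n \<le> x \<and> map_mat real_of_int A *\<^sub>v x \<le> map_vec real_of_int b}"

definition D :: "real vec set" where
  "D = {x \<in> X. \<forall>k<n. x $ k \<in> \<int>}"

definition f :: "nat \<Rightarrow> real vec \<Rightarrow> real" where
  "f i x = 1/2 * (x \<bullet> (map_mat real_of_int (Q i) *\<^sub>v x)) + map_vec real_of_int (c i) \<bullet> x"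

definition grad_f :: "nat \<Rightarrow> real vec \<Rightarrow> real vec" where
  "grad_f i x = map_mat real_of_int (Q i) *\<^sub>v x + map_vec real_of_int (c i)"

definition numer :: "nat \<Rightarrow> real vec \<Rightarrow> real" where
  "numer s x = p s \<bullet> x + \<alpha> s"

definition denom :: "nat \<Rightarrow> real vec \<Rightarrow> real" where
  "denom s x = q s \<bullet> x + \<beta> s"

definition \<psi> :: "nat \<Rightarrow> real vec \<Rightarrow> real" where
  "\<psi> s x = numer s x / denom s x"

definition X_Q :: "real vec set" where
  "X_Q = efficient_set D {1..r} f"

definition X_F :: "real vec set" where
  "X_F = efficient_set D {1, 2} \<psi>"

definition root :: node where
  "root = (mat m (n + m) (\<lambda>(i, j). if j < n then real_of_int (A $$ (i, j))
                                  else if j = n + i then 1 else 0),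
           map_vec real_of_int b)"

definition node_poly :: "node \<Rightarrow> real vec set" where
  "node_poly N = (\<lambda>y. vec_first y n) ` ext_points N"

lemma node_poly_root:
  assumes "A \<in> carrier_mat m n" "b \<in> carrier_vec m"
  shows "node_poly root = X"
proof -
  have row: "(\<Sum>j<n+m. (if j < n then real_of_int (A $$ (i, j)) else if j = n + i then 1 else 0) * y $ j)
    = (\<Sum>j<n. real_of_int (A $$ (i, j)) * y $ j) + y $ (n+i)" if "i < m" for i and y :: "real vec"
  proof -
    have "{..<n+m} = {..<n} \<union> {n..<n+m}" by auto
    moreover have "(\<Sum>j=n..<n+m. (if j < n then real_of_int (A $$ (i, j)) else if j = n + i then 1 else 0) * y $ j)
       = (\<Sum>j=n..<n+m. if j = n + i then y $ j else 0)" by (intro sum.cong) auto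
    ultimately show ?thesis using that by (simp add: sum.union_disjoint ivl_disj_int)
  qed
  have entry: "(fst root *\<^sub>v y) $ i =
      (\<Sum>j<n+m. (if j < n then real_of_int (A $$ (i, j)) else if j = n + i then 1 else 0) * y $ j)"
    if "i < m" "y \<in> carrier_vec (n + m)" for i y
    using that by (auto simp: root_def scalar_prod_def lessThan_atLeast0 intro!: sum.cong)
  have dims: "dim_row (fst root) = m" "dim_col (fst root) = n + m"
    and rhs: "snd root = map_vec real_of_int b" by (simp_all add: root_def)
  have eq: "fst root *\<^sub>v y = snd root \<longleftrightarrow>
     (\<forall>i<m. (\<Sum>j<n. real_of_int (A $$ (i, j)) * y $ j) + y $ (n+i) = real_of_int (b $ i))"
    if "y \<in> carrier_vec (n + m)" for y
  proof -
    have "fst root *\<^sub>v y = snd root \<longleftrightarrow> (\<forall>i<m. (fst root *\<^sub>v y) $ i = real_of_int (b $ i))"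
      using assms(2) by (auto simp: vec_eq_iff dims rhs simp del: index_mult_mat_vec)
    then show ?thesis using entry[OF _ that] row by simp
  qed
  have *: "y \<in> ext_points root \<longleftrightarrow> y \<in> carrier_vec (n+m) \<and> (\<forall>j<n+m. 0 \<le> y $ j) \<and>
     (\<forall>i<m. (\<Sum>j<n. real_of_int (A $$ (i, j)) * y $ j) + y $ (n+i) = real_of_int (b $ i))" for y
  proof (cases "y \<in> carrier_vec (n + m)")
    case True
    then have "0\<^sub>v (n + m) \<le> y \<longleftrightarrow> (\<forall>j<n+m. 0 \<le> y $ j)" by (auto simp: less_eq_vec_def)
    with True show ?thesis by (simp only: ext_points_def dims eq[OF True] mem_Collect_eq)
  qed (simp add: ext_points_def dims)
  have X: "x \<in> X \<longleftrightarrow> x \<in> carrier_vec n \<and> (\<forall>j<n. 0 \<le> x $ j) \<and>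
     (\<forall>i<m. (\<Sum>j<n. real_of_int (A $$ (i, j)) * x $ j) \<le> real_of_int (b $ i))" for x
  proof (cases "x \<in> carrier_vec n")
    case True
    have "(map_mat real_of_int A *\<^sub>v x) $ i = (\<Sum>j<n. real_of_int (A $$ (i, j)) * x $ j)" if "i < m" for i
      using True that assms by (auto simp: scalar_prod_def lessThan_atLeast0 intro!: sum.cong)
    then have "map_mat real_of_int A *\<^sub>v x \<le> map_vec real_of_int b \<longleftrightarrow>
        (\<forall>i<m. (\<Sum>j<n. real_of_int (A $$ (i, j)) * x $ j) \<le> real_of_int (b $ i))"
      using assms by (simp add: less_eq_vec_def del: index_mult_mat_vec)
    moreover have "0\<^sub>v n \<le> x \<longleftrightarrow> (\<forall>j<n. 0 \<le> x $ j)"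
      using True by (simp add: less_eq_vec_def)
    ultimately show ?thesis using True unfolding X_def by blast
  qed (simp add: X_def)
  show ?thesis
  proof (intro equalityI subsetI)
    fix x assume "x \<in> node_poly root"
    then obtain y where y: "y \<in> ext_points root" "x = vec_first y n" by (auto simp: node_poly_def)
    have "(\<Sum>j<n. real_of_int (A $$ (i, j)) * x $ j) \<le> real_of_int (b $ i)" if "i < m" for i
    proof -
      have "(\<Sum>j<n. real_of_int (A $$ (i, j)) * x $ j) = (\<Sum>j<n. real_of_int (A $$ (i, j)) * y $ j)"
        by (simp add: y(2) vec_first_def)
      moreover have "(\<Sum>j<n. real_of_int (A $$ (i, j)) * y $ j) + y $ (n+i) = real_of_int (b $ i)"
        and "0 \<le> y $ (n+i)" using y(1) that unfolding * by simp_all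
      ultimately show ?thesis by linarith
    qed
    moreover have "x \<in> carrier_vec n" and "\<forall>j<n. 0 \<le> x $ j"
      using y unfolding * by (simp_all add: vec_first_def)
    ultimately show "x \<in> X" unfolding X by blast
  next
    fix x assume x: "x \<in> X"
    define y where "y = x @\<^sub>v vec m (\<lambda>i. real_of_int (b $ i) - (\<Sum>j<n. real_of_int (A $$ (i, j)) * x $ j))"
    have dim: "dim_vec x = n" and sys: "\<forall>j<n. 0 \<le> x $ j"
      "\<forall>i<m. (\<Sum>j<n. real_of_int (A $$ (i, j)) * x $ j) \<le> real_of_int (b $ i)"
      using x unfolding X by auto
    have y1: "y $ j = x $ j" if "j < n" for j using that dim by (simp add: y_def)
    have y2: "y $ (n + i) = real_of_int (b $ i) - (\<Sum>j<n. real_of_int (A $$ (i, j)) * x $ j)"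
      if "i < m" for i using that dim by (simp add: y_def)
    have "0 \<le> y $ j" if "j < n + m" for j
    proof (cases "j < n")
      case False
      then obtain i where "j = n + i" "i < m" using \<open>j < n + m\<close> by (metis add_diff_inverse_nat nat_add_left_cancel_less)
      then show ?thesis using y2 sys(2) by simp
    qed (simp add: y1 sys(1))
    moreover have "y \<in> carrier_vec (n + m)" using dim by (intro carrier_vecI) (simp add: y_def)
    ultimately have "y \<in> ext_points root" unfolding * by (simp add: y1 y2)
    moreover have "x = vec_first y n" using dim y1 by (simp add: vec_first_def vec_eq_iff)
    ultimately show "x \<in> node_poly root" by (auto simp: node_poly_def)
  qed
qed

definition node_sol :: "node \<Rightarrow> nat list \<Rightarrow> real vec" where
  "node_sol N bs = vec_first (basic_sol N bs) n"

text \<open>Coefficient of variable \<open>k\<close> in a linear form on the original variables; slack and surplus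
  variables have coefficient \<open>0\<close>.\<close>

definition cost :: "real vec \<Rightarrow> nat \<Rightarrow> real" where
  "cost v k = (if k < n then v $ k else 0)"

definition reduced_cost :: "real vec \<Rightarrow> node \<Rightarrow> nat list \<Rightarrow> nat \<Rightarrow> real" where
  "reduced_cost v N bs j =
    cost v j - vec (length bs) (\<lambda>i. cost v (bs ! i)) \<bullet> (basis_inv (fst N) bs *\<^sub>v col (fst N) j)"

definition \<eta> :: "node \<Rightarrow> nat list \<Rightarrow> nat \<Rightarrow> nat \<Rightarrow> real" where
  "\<eta> N bs s j = reduced_cost (p s) N bs j"

definition \<theta> :: "node \<Rightarrow> nat list \<Rightarrow> nat \<Rightarrow> nat \<Rightarrow> real" where
  "\<theta> N bs s j = reduced_cost (q s) N bs j"

definition \<gamma> :: "node \<Rightarrow> nat list \<Rightarrow> nat \<Rightarrow> nat \<Rightarrow> real" where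
  "\<gamma> N bs s j =
    denom s (node_sol N bs) * \<eta> N bs s j - numer s (node_sol N bs) * \<theta> N bs s j"

definition f_bar :: "node \<Rightarrow> nat list \<Rightarrow> nat \<Rightarrow> nat \<Rightarrow> real" where
  "f_bar N bs i j =
    (if j < n then grad_f i (node_sol N bs) $ j else 0)
    - (\<Sum>k \<in> set bs \<inter> {..<n}. grad_f i (node_sol N bs) $ k * a_hat (fst N) bs $$ (row_of bs k, j))"

text \<open>A possible final outcome of the (dual) simplex method for minimizing \<open>\<psi> 1\<close> over the
  polyhedron of the node.\<close>

definition optimal_tableau :: "node \<Rightarrow> nat list \<Rightarrow> bool" where
  "optimal_tableau N bs \<longleftrightarrow>
     is_basis (fst N) bs \<and> basic_sol N bs \<in> ext_points N
     \<and> (\<forall>x \<in> node_poly N. \<psi> 1 (node_sol N bs) \<le> \<psi> 1 x)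
     \<and> (\<forall>j \<in> nonbasic (fst N) bs. \<gamma> N bs 1 j \<ge> 0)"

definition H :: "node \<Rightarrow> nat list \<Rightarrow> nat set" where
  "H N bs = {j \<in> nonbasic (fst N) bs. \<exists>i\<in>{1..r}. f_bar N bs i j < 0}
          \<union> {j \<in> nonbasic (fst N) bs. \<forall>i\<in>{1..r}. f_bar N bs i j = 0}"

definition H' :: "node \<Rightarrow> nat list \<Rightarrow> nat set" where
  "H' N bs = {j \<in> nonbasic (fst N) bs. \<gamma> N bs 2 j < 0}
           \<union> {j \<in> nonbasic (fst N) bs. \<gamma> N bs 1 j = 0 \<and> \<gamma> N bs 2 j = 0}"

definition T1_values :: "real vec \<Rightarrow> real set" where
  "T1_values x' = {(\<Sum>i=1..r. \<epsilon> i) | \<epsilon> x.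
     x \<in> D \<and> (\<forall>i\<in>{1..r}. f i x + \<epsilon> i \<le> f i x' \<and> \<epsilon> i \<ge> 0)}"

definition T2_values :: "real vec \<Rightarrow> real set" where
  "T2_values x' = {w 1 + w 2 | (w :: nat \<Rightarrow> real) x.
     x \<in> D \<and> (\<forall>s\<in>{1, 2}. (p s - \<psi> s x' \<cdot>\<^sub>v q s) \<bullet> x + w s \<le> \<psi> s x' * \<beta> s - \<alpha> s \<and> w s \<ge> 0)}"

definition passes_tests :: "real vec \<Rightarrow> bool" where
  "passes_tests x \<longleftrightarrow> is_max_value (T1_values x) 0 \<and> is_max_value (T2_values x) 0"

definition integral :: "real vec \<Rightarrow> bool" where
  "integral x \<longleftrightarrow> (\<forall>k<n. x $ k \<in> \<int>)"

definition update_Eff :: "real vec set \<Rightarrow> real vec \<Rightarrow> real vec set" where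
  "update_Eff E x = (if passes_tests x then E \<union> {x} else E)"

text \<open>One iteration of the algorithm, on states consisting of the multiset of open nodes and the
  current set of points found. Node selection, the optimal tableau and the branching
  variable are left nondeterministic.\<close>

inductive bc_step :: "node multiset \<times> real vec set \<Rightarrow> node multiset \<times> real vec set \<Rightarrow> bool" where
  infeasible:
    "N \<in># L \<Longrightarrow> node_poly N = {} \<Longrightarrow> bc_step (L, E) (L - {#N#}, E)"
| branch:
    "N \<in># L \<Longrightarrow> optimal_tableau N bs \<Longrightarrow> x = node_sol N bs \<Longrightarrow> k < n \<Longrightarrow> x $ k \<notin> \<int> \<Longrightarrow>
     bc_step (L, E)
       (L - {#N#} + {#add_le N (\<lambda>j. if j = k then 1 else 0) (of_int \<lfloor>x $ k\<rfloor>),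
                     add_ge N (\<lambda>j. if j = k then 1 else 0) (of_int \<lfloor>x $ k\<rfloor> + 1)#}, E)"
| fathom:
    "N \<in># L \<Longrightarrow> optimal_tableau N bs \<Longrightarrow> x = node_sol N bs \<Longrightarrow> integral x \<Longrightarrow>
     H N bs = {} \<or> H' N bs = {} \<Longrightarrow>
     bc_step (L, E) (L - {#N#}, update_Eff E x)"
| cut:
    "N \<in># L \<Longrightarrow> optimal_tableau N bs \<Longrightarrow> x = node_sol N bs \<Longrightarrow> integral x \<Longrightarrow>
     H N bs \<noteq> {} \<Longrightarrow> H' N bs \<noteq> {} \<Longrightarrow>
     bc_step (L, E)
       (L - {#N#} + {#add_ge (add_ge N (\<lambda>j. if j \<in> H N bs then 1 else 0) 1)
                             (\<lambda>j. if j \<in> H' N bs then 1 else 0) 1#}, update_Eff E x)"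

definition initial :: "node multiset \<times> real vec set" where
  "initial = ({#root#}, {})"

end

text \<open>Closedness and convexity of \<open>X\<close> hold by construction. In \<open>not_comb\<close> the equality of
  \<open>\<psi> s\<close> with a combination of the linear parts is an identity of functions on the whole
  domain of \<open>\<psi> s\<close>.\<close>

locale blf_moiqp = blf_data +
  assumes r_ge_2: "r \<ge> 2"
    and A_dim: "A \<in> carrier_mat m n"
    and b_dim: "b \<in> carrier_vec m"
    and Q_dim: "\<And>i. i \<in> {1..r} \<Longrightarrow> Q i \<in> carrier_mat n n"
    and Q_sym: "\<And>i. i \<in> {1..r} \<Longrightarrow> transpose_mat (Q i) = Q i"
    and Q_psd: "\<And>i x. i \<in> {1..r} \<Longrightarrow> x \<in> carrier_vec n \<Longrightarrow>
                  x \<bullet> (map_mat real_of_int (Q i) *\<^sub>v x) \<ge> 0"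
    and c_dim: "\<And>i. i \<in> {1..r} \<Longrightarrow> c i \<in> carrier_vec n"
    and p_dim: "\<And>s. s \<in> {1, 2} \<Longrightarrow> p s \<in> carrier_vec n"
    and q_dim: "\<And>s. s \<in> {1, 2} \<Longrightarrow> q s \<in> carrier_vec n"
    and X_nonempty: "X \<noteq> {}"
    and X_bounded: "\<exists>K. \<forall>x\<in>X. \<forall>k<n. \<bar>x $ k\<bar> \<le> K"
    and denom_pos: "\<And>s x. s \<in> {1, 2} \<Longrightarrow> x \<in> X \<Longrightarrow> denom s x > 0"
    and not_comb: "\<And>s. s \<in> {1, 2} \<Longrightarrow>
       \<not> (\<exists>w. (\<forall>i\<in>{1..r}. w i > 0) \<and>
            (\<forall>x\<in>carrier_vec n. denom s x \<noteq> 0 \<longrightarrow>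
               \<psi> s x = (\<Sum>i=1..r. w i * (map_vec real_of_int (c i) \<bullet> x))))"
    and X_Q_neq_D: "X_Q \<noteq> D"

end

theory Submission
  imports Defs "Jordan_Normal_Form.Determinant"
begin

text \<open>
  A run is a search tree whose nodes are polyhedra, so three things must be seen: that no branch
  goes on forever, that an iteration is possible whenever a node is open, and that no solution
  is lost on the way.

  \<^bold>\<open>Termination.\<close> The polyhedron of a child lies inside that of its parent, and the root polyhedron
  is bounded. Hence a node contains finitely many integral points, and in the direction of each
  coordinate it meets finitely many of the open strips between consecutive integers. Branching
  on a fractional coordinate clears the strip that contains it. The cuts remove the integral basic
  solution, whose nonbasic variables are all \<open>0\<close>; here one uses that the slack variables are
  determined by the original ones, so that the point cannot return with other slacks. The number of
  strips plus the number of integral points (\<open>work\<close>) therefore drops from a node to each child, and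
  the multiset of these numbers over the open nodes decreases in the multiset order.

  \<^bold>\<open>Progress.\<close> A node with nonempty polyhedron must have an optimal tableau, one whose reduced costs
  are nonnegative. For the optimal value \<open>v\<close> of the ratio, this is an optimal basis of the linear program
  with objective \<open>numer - v * denom\<close>. Under degeneracy a cheapest feasible basis need not have
  nonnegative reduced costs, and instead of an anticycling rule a perturbation of the right-hand
  side is used (\<open>exists_optimal_basis\<close>). Only pivots are needed for this: they turn any
  feasible point into a feasible basis and improve a basis that has a negative reduced cost.

  \<^bold>\<open>Completeness.\<close> Integral points have integral slack variables, so a cut can fail at such a point
  only if all variables in it vanish (\<open>zero_if_cut_violated\<close>). Writing the objectives in terms of
  the nonbasic variables, by convexity for the quadratic ones and exactly for the ratios, one sees that
  the point is then the basic solution itself or is dominated by it (\<open>efficient_satisfies_H_cut\<close>,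
  \<open>efficient_satisfies_H'_cut\<close>). Thus a point efficient for both problems survives in an open node
  until it is the basic solution of its node, and then it passes both tests.
\<close>

section \<open>Tableaus and pivots\<close>

lemma mult_mat_vec_nth:
  assumes "i < dim_row T" "z \<in> carrier_vec (dim_col T)"
  shows "(T *\<^sub>v z) $ i = (\<Sum>j<dim_col T. T $$ (i, j) * z $ j)"
  using assms by (auto simp: scalar_prod_def lessThan_atLeast0 intro!: sum.cong)

lemma basis_mat_carrier: "length bs = dim_row T \<Longrightarrow> basis_mat T bs \<in> carrier_mat (dim_row T) (dim_row T)"
  by (simp add: basis_mat_def mat_of_cols_def)

lemma basis_mat_index:
  assumes "i < dim_row T" "k < length bs" "bs ! k < dim_col T"
  shows "basis_mat T bs $$ (i, k) = T $$ (i, bs ! k)"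
  using assms by (simp add: basis_mat_def mat_of_cols_def)

lemma row_of_nth: "distinct bs \<Longrightarrow> i < length bs \<Longrightarrow> row_of bs (bs ! i) = i"
  unfolding row_of_def by (rule the_equality) (auto simp: nth_eq_iff_index_eq)

lemma sum_nth_eq_sum_set:
  "distinct bs \<Longrightarrow> (\<Sum>i<length bs. g (bs ! i)) = sum g (set bs)"
  by (simp add: sum_list_distinct_conv_sum_set[symmetric] sum_list_sum_nth atLeast0LessThan)

locale tableau =
  fixes T :: "real mat" and bs :: "nat list"
  assumes basis: "is_basis T bs"
begin

lemma distinct_basis: "distinct bs" and basis_subset: "set bs \<subseteq> {..<dim_col T}"
  and length_basis: "length bs = dim_row T"
  using basis by (auto simp: is_basis_def)

lemma basis_nth_less: "i < dim_row T \<Longrightarrow> bs ! i < dim_col T"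
  using subsetD[OF basis_subset nth_mem[of i bs]] by (simp add: length_basis)

lemma basis_inv:
  "basis_inv T bs \<in> carrier_mat (dim_row T) (dim_row T)"
  "basis_inv T bs * basis_mat T bs = 1\<^sub>m (dim_row T)"
  "basis_mat T bs * basis_inv T bs = 1\<^sub>m (dim_row T)"
proof -
  have B: "basis_mat T bs \<in> carrier_mat (dim_row T) (dim_row T)"
    by (rule basis_mat_carrier[OF length_basis])
  obtain C where C: "basis_mat T bs * C = 1\<^sub>m (dim_row T)" "C * basis_mat T bs = 1\<^sub>m (dim_row C)"
    using basis B unfolding is_basis_def invertible_mat_def inverts_mat_def by auto
  have "C \<in> carrier_mat (dim_row T) (dim_row T)"
    using C B by (metis carrier_matD(2) carrier_matI index_mult_mat(3) index_one_mat(3))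
  with B C have "basis_mat T bs \<in> Units (ring_mat TYPE(real) (dim_row T) ())"
    by (auto simp: Units_def ring_mat_simps)
  with mat_inverse(1)[OF B, of "()"] obtain C' where C': "mat_inverse (basis_mat T bs) = Some C'"
    by (cases "mat_inverse (basis_mat T bs)") auto
  with mat_inverse(2)[OF B C']
  show "basis_inv T bs \<in> carrier_mat (dim_row T) (dim_row T)"
  "basis_inv T bs * basis_mat T bs = 1\<^sub>m (dim_row T)"
  "basis_mat T bs * basis_inv T bs = 1\<^sub>m (dim_row T)"
    by (auto simp: basis_inv_def)
qed

lemma a_hat_carrier: "a_hat T bs \<in> carrier_mat (dim_row T) (dim_col T)"
  using basis_inv(1) by (simp add: a_hat_def)

lemma a_hat_basic:
  assumes "i < dim_row T" "k < dim_row T"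
  shows "a_hat T bs $$ (i, bs ! k) = (if i = k then 1 else 0)"
proof -
  have "col T (bs ! k) = col (basis_mat T bs) k"
    using assms basis_nth_less[OF assms(2)] length_basis basis_mat_carrier[OF length_basis]
    by (auto simp: vec_eq_iff basis_mat_index)
  then have "a_hat T bs $$ (i, bs ! k) = (basis_inv T bs * basis_mat T bs) $$ (i, k)"
    using assms basis_nth_less[OF assms(2)] basis_inv(1) basis_mat_carrier[OF length_basis]
    by (simp add: a_hat_def)
  also have "\<dots> = (if i = k then 1 else 0)" unfolding basis_inv(2) using assms by simp
  finally show ?thesis .
qed

lemma sum_basic_nonbasic:
  fixes g :: "nat \<Rightarrow> real"
  shows "(\<Sum>j<dim_col T. g j) = (\<Sum>i<dim_row T. g (bs ! i)) + (\<Sum>j\<in>nonbasic T bs. g j)"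
proof -
  have "(\<Sum>j<dim_col T. g j) = sum g (set bs) + sum g ({..<dim_col T} - set bs)"
    using basis_subset by (subst sum.subset_diff[of "set bs"]) auto
  then show ?thesis
    using sum_nth_eq_sum_set[OF distinct_basis, of g] by (simp add: nonbasic_def length_basis)
qed

lemma finite_nonbasic: "finite (nonbasic T bs)"
  by (simp add: nonbasic_def)

text \<open>Multiplication by the invertible basis inverse is injective, so the system can be read
  off its tableau.\<close>

lemma solves_iff_tableau:
  assumes z: "z \<in> carrier_vec (dim_col T)" and h: "h \<in> carrier_vec (dim_row T)"
  shows "T *\<^sub>v z = h \<longleftrightarrow> (\<forall>i<dim_row T.
    z $ (bs ! i) + (\<Sum>j\<in>nonbasic T bs. a_hat T bs $$ (i, j) * z $ j) = b_hat (T, h) bs $ i)"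
proof -
  let ?C = "basis_inv T bs" and ?B = "basis_mat T bs"
  have B: "?B \<in> carrier_mat (dim_row T) (dim_row T)"
    by (rule basis_mat_carrier[OF length_basis])
  have TN: "T \<in> carrier_mat (dim_row T) (dim_col T)" by simp
  have BC: "?B *\<^sub>v (?C *\<^sub>v v) = v" if "v \<in> carrier_vec (dim_row T)" for v
    using that B basis_inv by (simp add: assoc_mult_mat_vec[symmetric])
  have Tz: "T *\<^sub>v z \<in> carrier_vec (dim_row T)"
    using mult_mat_vec_carrier[OF TN z] .
  have "T *\<^sub>v z = h \<longleftrightarrow> ?C *\<^sub>v (T *\<^sub>v z) = ?C *\<^sub>v h"
    using BC[OF Tz] BC[OF h] by metis
  also have "?C *\<^sub>v (T *\<^sub>v z) = a_hat T bs *\<^sub>v z"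
    unfolding a_hat_def by (rule assoc_mult_mat_vec[OF basis_inv(1) TN z, symmetric])
  also have "?C *\<^sub>v h = b_hat (T, h) bs" by (simp add: b_hat_def)
  also have "a_hat T bs *\<^sub>v z = b_hat (T, h) bs \<longleftrightarrow>
      (\<forall>i<dim_row T. (a_hat T bs *\<^sub>v z) $ i = b_hat (T, h) bs $ i)"
    using basis_inv(1) a_hat_carrier by (auto simp: vec_eq_iff b_hat_def)
  also have "\<dots> \<longleftrightarrow> (\<forall>i<dim_row T. 
    z $ (bs ! i) + (\<Sum>j\<in>nonbasic T bs. a_hat T bs $$ (i, j) * z $ j) = b_hat (T, h) bs $ i)"
  proof (intro all_cong)
    fix i assume i: "i < dim_row T"
    have "(a_hat T bs *\<^sub>v z) $ i = (\<Sum>j<dim_col T. a_hat T bs $$ (i, j) * z $ j)"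
      using i a_hat_carrier z by (subst mult_mat_vec_nth) auto
    also have "\<dots> = (\<Sum>k<dim_row T. a_hat T bs $$ (i, bs ! k) * z $ (bs ! k))
        + (\<Sum>j\<in>nonbasic T bs. a_hat T bs $$ (i, j) * z $ j)" by (rule sum_basic_nonbasic)
    also have "(\<Sum>k<dim_row T. a_hat T bs $$ (i, bs ! k) * z $ (bs ! k))
        = (\<Sum>k<dim_row T. if k = i then z $ (bs ! k) else 0)"
      using i by (intro sum.cong) (auto simp: a_hat_basic)
    also have "\<dots> = z $ (bs ! i)" using i by simp
    finally show "(a_hat T bs *\<^sub>v z) $ i = b_hat (T, h) bs $ i \<longleftrightarrow>
      z $ (bs ! i) + (\<Sum>j\<in>nonbasic T bs. a_hat T bs $$ (i, j) * z $ j) = b_hat (T, h) bs $ i"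
      by simp
  qed
  finally show ?thesis .
qed

lemma b_hat_zero: "i < dim_row T \<Longrightarrow> b_hat (T, 0\<^sub>v (dim_row T)) bs $ i = 0"
  using basis_inv(1) by (auto simp: b_hat_def)

lemma basic_sol_carrier: "basic_sol (T, h) bs \<in> carrier_vec (dim_col T)"
  by (simp add: basic_sol_def)

lemma basic_sol_basic:
  "i < dim_row T \<Longrightarrow> basic_sol (T, h) bs $ (bs ! i) = b_hat (T, h) bs $ i"
  by (simp add: basic_sol_def basis_nth_less length_basis row_of_nth[OF distinct_basis])

lemma basic_sol_nonbasic: "j \<in> nonbasic T bs \<Longrightarrow> basic_sol (T, h) bs $ j = 0"
  by (simp add: basic_sol_def nonbasic_def)

lemma basic_or_nonbasic:
  assumes "k < dim_col T"
  obtains i where "i < dim_row T" "k = bs ! i" | "k \<in> nonbasic T bs"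
  using assms by (cases "k \<in> set bs") (auto simp: in_set_conv_nth length_basis nonbasic_def)

lemma basic_sol_solves:
  "h \<in> carrier_vec (dim_row T) \<Longrightarrow> T *\<^sub>v basic_sol (T, h) bs = h"
  by (simp add: solves_iff_tableau[OF basic_sol_carrier] basic_sol_basic basic_sol_nonbasic)

lemma solution_eq_basic_sol:
  assumes "z \<in> carrier_vec (dim_col T)" "h \<in> carrier_vec (dim_row T)" "T *\<^sub>v z = h"
    and "\<And>j. j \<in> nonbasic T bs \<Longrightarrow> z $ j = 0"
  shows "z = basic_sol (T, h) bs"
proof (rule eq_vecI)
  fix k assume "k < dim_vec (basic_sol (T, h) bs)"
  then have "k < dim_col T" by (simp add: basic_sol_def)
  then show "z $ k = basic_sol (T, h) bs $ k"
    using assms(3) unfolding solves_iff_tableau[OF assms(1,2)]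
    by (cases rule: basic_or_nonbasic) (auto simp: assms(4) basic_sol_basic basic_sol_nonbasic)
qed (use assms(1) in \<open>simp add: basic_sol_def\<close>)

text \<open>The reduced cost of column \<open>j\<close> for the linear form with coefficients \<open>d\<close>.\<close>

definition rel_cost :: "(nat \<Rightarrow> real) \<Rightarrow> nat \<Rightarrow> real" where
  "rel_cost d j = d j - (\<Sum>i<dim_row T. d (bs ! i) * a_hat T bs $$ (i, j))"

text \<open>Eliminating the basic variables turns every linear form into its value at the basic
  solution plus the relative costs of the nonbasic variables.\<close>

lemma linear_form_eq:
  assumes z: "z \<in> carrier_vec (dim_col T)" and h: "h \<in> carrier_vec (dim_row T)"
    and sol: "T *\<^sub>v z = h"
  shows "(\<Sum>k<dim_col T. d k * z $ k) = (\<Sum>k<dim_col T. d k * basic_sol (T, h) bs $ k)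
    + (\<Sum>j\<in>nonbasic T bs. rel_cost d j * z $ j)"
proof -
  let ?S = "\<lambda>i. \<Sum>j\<in>nonbasic T bs. a_hat T bs $$ (i, j) * z $ j"
  have row: "z $ (bs ! i) = b_hat (T, h) bs $ i - ?S i" if "i < dim_row T" for i
    using iffD1[OF solves_iff_tableau[OF z h] sol, rule_format, OF that] by linarith
  have "(\<Sum>i<dim_row T. d (bs ! i) * z $ (bs ! i))
      = (\<Sum>i<dim_row T. d (bs ! i) * b_hat (T, h) bs $ i - d (bs ! i) * ?S i)"
    by (rule sum.cong[OF refl]) (simp add: row right_diff_distrib)
  also have "\<dots> = (\<Sum>i<dim_row T. d (bs ! i) * b_hat (T, h) bs $ i) - (\<Sum>i<dim_row T. d (bs ! i) * ?S i)"
    by (rule sum_subtractf)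
  also have "(\<Sum>i<dim_row T. d (bs ! i) * ?S i)
    = (\<Sum>i<dim_row T. \<Sum>j\<in>nonbasic T bs. (d (bs ! i) * a_hat T bs $$ (i, j)) * z $ j)"
    by (simp only: sum_distrib_left mult.assoc)
  also have "\<dots> = (\<Sum>j\<in>nonbasic T bs. (\<Sum>i<dim_row T. d (bs ! i) * a_hat T bs $$ (i, j)) * z $ j)"
    by (subst sum.swap) (simp only: sum_distrib_right)
  finally have basic: "(\<Sum>i<dim_row T. d (bs ! i) * z $ (bs ! i)) =
    (\<Sum>i<dim_row T. d (bs ! i) * b_hat (T, h) bs $ i)
    - (\<Sum>j\<in>nonbasic T bs. (\<Sum>i<dim_row T. d (bs ! i) * a_hat T bs $$ (i, j)) * z $ j)" .
  have "(\<Sum>k<dim_col T. d k * basic_sol (T, h) bs $ k) = (\<Sum>i<dim_row T. d (bs ! i) * b_hat (T, h) bs $ i)"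
    unfolding sum_basic_nonbasic[of "\<lambda>k. d k * basic_sol (T, h) bs $ k"]
    by (simp add: basic_sol_basic basic_sol_nonbasic)
  moreover have "(\<Sum>k<dim_col T. d k * z $ k)
      = (\<Sum>i<dim_row T. d (bs ! i) * z $ (bs ! i)) + (\<Sum>j\<in>nonbasic T bs. d j * z $ j)"
    by (rule sum_basic_nonbasic)
  ultimately show ?thesis
    unfolding basic by (simp add: rel_cost_def left_diff_distrib sum_subtractf)
qed

text \<open>The direction in which the nonbasic variable \<open>j\<close> grows at unit speed, the basic variables
  compensate, and the other nonbasic variables stay fixed.\<close>

definition edge :: "nat \<Rightarrow> real vec" where
  "edge j = vec (dim_col T) (\<lambda>k. if k = j then 1
     else if k \<in> set bs then - a_hat T bs $$ (row_of bs k, j) else 0)"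

lemma edge_carrier: "edge j \<in> carrier_vec (dim_col T)"
  by (simp add: edge_def)

lemma edge_basic:
  "i < dim_row T \<Longrightarrow> j \<in> nonbasic T bs \<Longrightarrow> edge j $ (bs ! i) = - a_hat T bs $$ (i, j)"
  using basis_nth_less length_basis nth_mem[of i bs]
  by (auto simp: edge_def row_of_nth[OF distinct_basis] nonbasic_def)

lemma edge_nonbasic:
  "k \<in> nonbasic T bs \<Longrightarrow> edge j $ k = (if k = j then 1 else 0)"
  by (auto simp: edge_def nonbasic_def)

lemma sum_edge:
  assumes "j \<in> nonbasic T bs"
  shows "(\<Sum>k\<in>nonbasic T bs. g k * edge j $ k) = g j"
proof -
  have "(\<Sum>k\<in>nonbasic T bs. g k * edge j $ k) = (\<Sum>k\<in>nonbasic T bs. if k = j then g k else 0)"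
    by (rule sum.cong) (auto simp: edge_nonbasic)
  then show ?thesis using assms finite_nonbasic by simp
qed

lemma edge_kernel:
  assumes "j \<in> nonbasic T bs"
  shows "T *\<^sub>v edge j = 0\<^sub>v (dim_row T)"
  using assms by (simp add: solves_iff_tableau[OF edge_carrier] b_hat_zero edge_basic sum_edge)

lemma move_along_edge:
  assumes "j \<in> nonbasic T bs" "y \<in> carrier_vec (dim_col T)" "T *\<^sub>v y = h"
  shows "T *\<^sub>v (y + t \<cdot>\<^sub>v edge j) = h"
proof -
  have TN: "T \<in> carrier_mat (dim_row T) (dim_col T)" by simp
  have "T *\<^sub>v (y + t \<cdot>\<^sub>v edge j) = T *\<^sub>v y + T *\<^sub>v (t \<cdot>\<^sub>v edge j)"
    using assms(2) edge_carrier by (intro mult_add_distrib_mat_vec[OF TN]) auto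
  also have "T *\<^sub>v (t \<cdot>\<^sub>v edge j) = t \<cdot>\<^sub>v (T *\<^sub>v edge j)"
    by (rule mult_mat_vec[OF TN edge_carrier])
  finally show ?thesis using assms(3) by (auto simp: edge_kernel[OF assms(1)])
qed

end

lemma invertible_mat_if_trivial_kernel:
  fixes B :: "real mat"
  assumes B: "B \<in> carrier_mat M M"
    and ker: "\<And>w. w \<in> carrier_vec M \<Longrightarrow> B *\<^sub>v w = 0\<^sub>v M \<Longrightarrow> w = 0\<^sub>v M"
  shows "invertible_mat B"
proof -
  have "det B \<noteq> 0" using det_0_iff_vec_prod_zero[OF B] ker by blast
  from det_non_zero_imp_unit[OF B this, of "()"]
  obtain C where "C \<in> carrier_mat M M" "B * C = 1\<^sub>m M" "C * B = 1\<^sub>m M"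
    unfolding Units_def ring_mat_simps by blast
  moreover have "square_mat B" using B by simp
  ultimately show ?thesis
    unfolding invertible_mat_def inverts_mat_def using carrier_matD(1) B by metis
qed

text \<open>A combination of the selected columns is the image of a vector that is supported on the
  basic variables, so the kernel condition on \<open>T\<close> is linear independence of these columns. This
  form suits pivots, because kernel vectors can be read through the tableau.\<close>

lemma is_basisI:
  assumes bs: "distinct bs" "set bs \<subseteq> {..<dim_col T}" "length bs = dim_row T"
    and ker: "\<And>z. z \<in> carrier_vec (dim_col T) \<Longrightarrow> T *\<^sub>v z = 0\<^sub>v (dim_row T)
      \<Longrightarrow> (\<And>j. j \<in> nonbasic T bs \<Longrightarrow> z $ j = 0) \<Longrightarrow> z = 0\<^sub>v (dim_col T)"
  shows "is_basis T bs"
proof -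
  let ?B = "basis_mat T bs"
  have B: "?B \<in> carrier_mat (dim_row T) (dim_row T)" by (rule basis_mat_carrier[OF bs(3)])
  have less: "bs ! k < dim_col T" if "k < dim_row T" for k
    using subsetD[OF bs(2) nth_mem[of k bs]] that by (simp add: bs(3))
  have "invertible_mat ?B"
  proof (rule invertible_mat_if_trivial_kernel[OF B])
    fix w assume w: "w \<in> carrier_vec (dim_row T)" "?B *\<^sub>v w = 0\<^sub>v (dim_row T)"
    define z where "z = vec (dim_col T) (\<lambda>k. if k \<in> set bs then w $ row_of bs k else 0)"
    have zb: "z $ (bs ! k) = w $ k" if "k < dim_row T" for k
      using that less[OF that] bs(3) by (simp add: z_def row_of_nth[OF bs(1)])
    have zc: "z \<in> carrier_vec (dim_col T)" by (simp add: z_def)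
    have zn: "z $ j = 0" if "j \<in> nonbasic T bs" for j
      using that by (auto simp: nonbasic_def z_def)
    have "T *\<^sub>v z = ?B *\<^sub>v w"
    proof (rule eq_vecI)
      fix i assume "i < dim_vec (?B *\<^sub>v w)"
      then have i: "i < dim_row T" using B by simp
      have "(T *\<^sub>v z) $ i = (\<Sum>j<dim_col T. T $$ (i, j) * z $ j)"
        by (rule mult_mat_vec_nth[OF i zc])
      also have "\<dots> = (\<Sum>j\<in>set bs. T $$ (i, j) * z $ j)"
        by (rule sum.mono_neutral_right) (use bs(2) zn in \<open>auto simp: nonbasic_def\<close>)
      also have "\<dots> = (\<Sum>k<dim_row T. T $$ (i, bs ! k) * z $ (bs ! k))"
        by (rule sum_nth_eq_sum_set[OF bs(1), of "\<lambda>j. T $$ (i, j) * z $ j", unfolded bs(3), symmetric])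
      also have "\<dots> = (\<Sum>k<dim_row T. ?B $$ (i, k) * w $ k)"
      proof (rule sum.cong[OF refl])
        fix k assume "k \<in> {..<dim_row T}"
        then have k: "k < dim_row T" by simp
        show "T $$ (i, bs ! k) * z $ (bs ! k) = ?B $$ (i, k) * w $ k"
          using basis_mat_index[OF i _ less[OF k]] k bs(3) zb[OF k] by simp
      qed
      also have "\<dots> = (?B *\<^sub>v w) $ i"
        by (rule mult_mat_vec_nth[of i ?B w, unfolded carrier_matD[OF B], OF i w(1), symmetric])
      finally show "(T *\<^sub>v z) $ i = (?B *\<^sub>v w) $ i" .
    qed (use B in simp)
    with w(2) have z0: "z = 0\<^sub>v (dim_col T)" by (intro ker zc zn) simp
    show "w = 0\<^sub>v (dim_row T)"
    proof (rule eq_vecI)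
      fix k assume "k < dim_vec (0\<^sub>v (dim_row T) :: real vec)"
      then have k: "k < dim_row T" by simp
      show "w $ k = 0\<^sub>v (dim_row T) $ k"
        using zb[OF k] k less[OF k] unfolding z0 by simp
    qed (use w(1) in simp)
  qed
  then show ?thesis unfolding is_basis_def by (intro conjI bs)
qed

lemma (in tableau) nonbasic_pivot:
  assumes i: "i < dim_row T" and j: "j \<in> nonbasic T bs"
  shows "nonbasic T (bs[i := j]) = insert (bs ! i) (nonbasic T bs - {j})"
proof -
  have len: "i < length bs" using i length_basis by simp
  have "N - insert j (S - {k}) = insert k (N - S - {j})"
    if "k \<in> N" "k \<in> S" "j \<in> N - S" for k N S
    using that by blast
  from this[OF _ nth_mem[OF len] j[unfolded nonbasic_def]] show ?thesis
    unfolding nonbasic_def set_update_distinct[OF distinct_basis len]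
    using basis_nth_less[OF i] by blast
qed

text \<open>A kernel vector supported on the new basis has \<open>z $ (bs ! i) = 0\<close>, and the only other entry that
  can contribute to row \<open>i\<close> of the old tableau is \<open>z $ j\<close>. With a nonzero pivot element that entry
  vanishes too, and independence of the old basis does the rest.\<close>

lemma (in tableau) basis_pivot:
  assumes i: "i < dim_row T" and j: "j \<in> nonbasic T bs" and ne: "a_hat T bs $$ (i, j) \<noteq> 0"
  shows "is_basis T (bs[i := j])"
proof (rule is_basisI)
  have jb: "j < dim_col T" "j \<notin> set bs" using j by (simp_all add: nonbasic_def)
  show "distinct (bs[i := j])"
    using jb(2) by (intro distinct_list_update distinct_basis) auto
  show "set (bs[i := j]) \<subseteq> {..<dim_col T}"
    using basis_subset jb(1) set_update_subset_insert[of bs i j] by blast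
  show "length (bs[i := j]) = dim_row T" by (simp add: length_basis)
next
  note nb = nonbasic_pivot[OF i j]
  show "z = 0\<^sub>v (dim_col T)" if z: "z \<in> carrier_vec (dim_col T)" "T *\<^sub>v z = 0\<^sub>v (dim_row T)"
    and zn: "\<And>k. k \<in> nonbasic T (bs[i := j]) \<Longrightarrow> z $ k = 0" for z
  proof -
    have zj: "k \<in> nonbasic T bs \<Longrightarrow> k \<noteq> j \<Longrightarrow> z $ k = 0" for k
      by (rule zn) (simp add: nb)
    have "(\<Sum>k\<in>nonbasic T bs. a_hat T bs $$ (i, k) * z $ k)
      = (\<Sum>k\<in>nonbasic T bs. if k = j then a_hat T bs $$ (i, k) * z $ k else 0)"
      by (rule sum.cong[OF refl]) (simp add: zj)
    also have "\<dots> = a_hat T bs $$ (i, j) * z $ j"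
      using j by (simp add: sum.delta[OF finite_nonbasic])
    finally have sum: "(\<Sum>k\<in>nonbasic T bs. a_hat T bs $$ (i, k) * z $ k) = a_hat T bs $$ (i, j) * z $ j" .
    have "z $ (bs ! i) + (\<Sum>k\<in>nonbasic T bs. a_hat T bs $$ (i, k) * z $ k) = b_hat (T, 0\<^sub>v (dim_row T)) bs $ i"
      using iffD1[OF solves_iff_tableau[OF z(1) zero_carrier_vec] z(2)] i by blast
    then have "z $ (bs ! i) + a_hat T bs $$ (i, j) * z $ j = 0"
      unfolding sum b_hat_zero[OF i] .
    moreover have "z $ (bs ! i) = 0" by (rule zn) (simp add: nb)
    ultimately have "z $ j = 0" using ne by simp
    then have "z = basic_sol (T, 0\<^sub>v (dim_row T)) bs"
      by (intro solution_eq_basic_sol z zero_carrier_vec) (use zj in blast)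
    moreover have "0\<^sub>v (dim_col T) = basic_sol (T, 0\<^sub>v (dim_row T)) bs"
    proof (rule solution_eq_basic_sol)
      show "T *\<^sub>v 0\<^sub>v (dim_col T) = 0\<^sub>v (dim_row T)" by (rule eq_vecI) auto
    qed (auto simp: nonbasic_def)
    ultimately show ?thesis by simp
  qed
qed

section \<open>Optimal bases of linear programs\<close>

definition feasible_basis :: "real mat \<Rightarrow> real vec \<Rightarrow> nat list \<Rightarrow> bool" where
  "feasible_basis T h bs \<longleftrightarrow> is_basis T bs \<and> (\<forall>k<dim_col T. 0 \<le> basic_sol (T, h) bs $ k)"

text \<open>The ratio test. Moving from \<open>y\<close> in direction \<open>w\<close>, the step with the least ratio is the one at
  which the first coordinate reaches \<open>0\<close>.\<close>

lemma blocking_coordinate: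
  fixes y w :: "real vec"
  assumes y: "\<And>k. k < N \<Longrightarrow> 0 \<le> y $ k" and k0: "k0 < N" "w $ k0 < 0"
  obtains k where "k < N" "w $ k < 0" "\<And>l. l < N \<Longrightarrow> 0 \<le> y $ l + (y $ k / - w $ k) * w $ l"
proof -
  let ?S = "{k. k < N \<and> w $ k < 0}" and ?r = "\<lambda>k. y $ k / - w $ k"
  have "finite ?S" "?S \<noteq> {}" using k0 by auto
  then obtain k where k: "k \<in> ?S" and le: "\<And>l. l \<in> ?S \<Longrightarrow> ?r k \<le> ?r l"
    using ex_is_arg_min_if_finite[of ?S ?r] unfolding is_arg_min_linorder by blast
  have "0 \<le> y $ l + ?r k * w $ l" if l: "l < N" for l
  proof (cases "w $ l < 0")
    case True
    then have "?r k * (- w $ l) \<le> ?r l * (- w $ l)"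
      using l le by (intro mult_right_mono) auto
    also have "\<dots> = y $ l" using True by simp
    finally show ?thesis by simp
  next
    case False
    moreover have "0 \<le> ?r k" using k y[of k] by (intro divide_nonneg_pos) auto
    ultimately show ?thesis using y[OF l] by (intro add_nonneg_nonneg mult_nonneg_nonneg) auto
  qed
  with k show thesis by (intro that[of k]) auto
qed

lemma (in tableau) move_nth:
  "l < dim_col T \<Longrightarrow> (y + t \<cdot>\<^sub>v edge j) $ l = y $ l + t * edge j $ l"
  using edge_carrier[of j] by simp

lemma (in tableau) move_carrier:
  "y \<in> carrier_vec (dim_col T) \<Longrightarrow> y + t \<cdot>\<^sub>v edge j \<in> carrier_vec (dim_col T)"
  using edge_carrier[of j] by simp

lemma (in tableau) nonbasic_less: "l \<in> nonbasic T bs \<Longrightarrow> l < dim_col T"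
  by (simp add: nonbasic_def)

text \<open>Every nonbasic variable that is positive is lowered along its edge until it vanishes, or
  until a basic variable vanishes, with which it is then exchanged. Either way one nonzero
  nonbasic variable disappears.\<close>

lemma exists_feasible_basis:
  assumes "is_basis T bs" and "h \<in> carrier_vec (dim_row T)"
    and "y \<in> carrier_vec (dim_col T)" "T *\<^sub>v y = h" "\<And>k. k < dim_col T \<Longrightarrow> 0 \<le> y $ k"
  shows "\<exists>bs'. feasible_basis T h bs'"
  using assms(1,3-)
proof (induction "card {j \<in> nonbasic T bs. y $ j \<noteq> 0}" arbitrary: y bs rule: less_induct)
  case less
  interpret tableau T bs using less.prems(1) by unfold_locales
  note h = assms(2) and y = less.prems(2,3,4)
  show ?case
  proof (cases "\<exists>j\<in>nonbasic T bs. y $ j \<noteq> 0")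
    case False
    then have "y = basic_sol (T, h) bs" by (intro solution_eq_basic_sol[OF y(1) h y(2)]) blast
    with less.prems(1) y(3) show ?thesis unfolding feasible_basis_def by blast
  next
    case True
    then obtain j where j: "j \<in> nonbasic T bs" "y $ j \<noteq> 0" by blast
    \<comment> \<open>The variable \<open>j\<close> is itself among the candidates for blocking, which guarantees that there is one.\<close>
    define w where "w = - edge j"
    have w: "w $ l = - edge j $ l" if "l < dim_col T" for l
      using that edge_carrier[of j] by (simp add: w_def)
    have wj: "w $ j < 0" using w[OF nonbasic_less[OF j(1)]] edge_nonbasic[OF j(1), of j] by simp
    obtain k where k: "k < dim_col T" "w $ k < 0"
      and ge: "\<And>l. l < dim_col T \<Longrightarrow> 0 \<le> y $ l + (y $ k / - w $ k) * w $ l"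
      using blocking_coordinate[OF y(3) nonbasic_less[OF j(1)] wj] by blast
    define y' where "y' = y + (- (y $ k / - w $ k)) \<cdot>\<^sub>v edge j"
    have y'_nth: "y' $ l = y $ l + (y $ k / - w $ k) * w $ l" if "l < dim_col T" for l
      unfolding y'_def move_nth[OF that] w[OF that] by (simp only: minus_mult_minus mult_minus_left mult_minus_right)
    have "y' \<in> carrier_vec (dim_col T)" "T *\<^sub>v y' = h"
      unfolding y'_def by (fact move_carrier[OF y(1)], fact move_along_edge[OF j(1) y(1,2)])
    moreover have "\<And>l. l < dim_col T \<Longrightarrow> 0 \<le> y' $ l" using ge by (simp only: y'_nth)
    ultimately have y': "y' \<in> carrier_vec (dim_col T)" "T *\<^sub>v y' = h" "\<And>l. l < dim_col T \<Longrightarrow> 0 \<le> y' $ l" .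
    have y'k: "y' $ k = 0" using y'_nth[OF k(1)] k(2) by simp
    have same: "y' $ l = y $ l" if "l \<in> nonbasic T bs" "l \<noteq> j" for l
      using y'_nth[OF nonbasic_less] w[OF nonbasic_less] edge_nonbasic[of l j] that by simp
    let ?Z = "{l \<in> nonbasic T bs. y $ l \<noteq> 0}"
    have finZ: "finite ?Z" using finite_nonbasic by simp
    show ?thesis
    proof (cases rule: basic_or_nonbasic[OF k(1)])
      case (1 i)
      have "a_hat T bs $$ (i, j) \<noteq> 0"
        using edge_basic[OF 1(1) j(1)] w[OF k(1)] k(2) 1(2) by simp
      note B = basis_pivot[OF 1(1) j(1) this]
      have "{l \<in> nonbasic T (bs[i := j]). y' $ l \<noteq> 0} \<subseteq> ?Z - {j}"
        unfolding nonbasic_pivot[OF 1(1) j(1)] using same y'k 1(2) by auto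
      then have "{l \<in> nonbasic T (bs[i := j]). y' $ l \<noteq> 0} \<subset> ?Z" using j by blast
      from less.hyps[OF psubset_card_mono[OF finZ this] B y'] show ?thesis .
    next
      case 2
      then have "k = j" using edge_nonbasic[OF 2, of j] w[OF k(1)] k(2) by (cases "k = j") auto
      then have "{l \<in> nonbasic T bs. y' $ l \<noteq> 0} \<subseteq> ?Z - {j}"
        using same y'k by (smt (verit) Diff_iff mem_Collect_eq singletonD subsetI)
      then have "{l \<in> nonbasic T bs. y' $ l \<noteq> 0} \<subset> ?Z" using j by blast
      from less.hyps[OF psubset_card_mono[OF finZ this] less.prems(1) y'] show ?thesis .
    qed
  qed
qed

text \<open>At a nondegenerate basis a negative relative cost would permit a step of positive length along
  the edge. As the recession cone is trivial, some basic variable stops the step, and the pivot with it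
  yields a cheaper feasible basis.\<close>

lemma (in tableau) rel_cost_nonneg_if_cheapest:
  assumes feas: "feasible_basis T h bs" and h: "h \<in> carrier_vec (dim_row T)"
    and nondeg: "\<And>i. i < dim_row T \<Longrightarrow> b_hat (T, h) bs $ i \<noteq> 0"
    and rec: "\<And>z. z \<in> carrier_vec (dim_col T) \<Longrightarrow> (\<And>k. k < dim_col T \<Longrightarrow> 0 \<le> z $ k)
      \<Longrightarrow> T *\<^sub>v z = 0\<^sub>v (dim_row T) \<Longrightarrow> z = 0\<^sub>v (dim_col T)"
    and cheapest: "\<And>bs'. feasible_basis T h bs' \<Longrightarrow> (\<Sum>k<dim_col T. d k * basic_sol (T, h) bs $ k)
      \<le> (\<Sum>k<dim_col T. d k * basic_sol (T, h) bs' $ k)"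
    and j: "j \<in> nonbasic T bs"
  shows "0 \<le> rel_cost d j"
proof (rule ccontr)
  assume neg: "\<not> 0 \<le> rel_cost d j"
  let ?y = "basic_sol (T, h) bs"
  have y: "0 \<le> ?y $ k" if "k < dim_col T" for k using feas that by (simp add: feasible_basis_def)
  have "\<exists>k<dim_col T. edge j $ k < 0"
  proof (rule ccontr)
    assume "\<not> ?thesis"
    then have "edge j = 0\<^sub>v (dim_col T)"
      by (intro rec edge_carrier edge_kernel j) auto
    moreover have "edge j $ j = 1" using edge_nonbasic[OF j, of j] by simp
    ultimately show False using nonbasic_less[OF j] by simp
  qed
  then obtain k where k: "k < dim_col T" "edge j $ k < 0"
    and ge: "\<And>l. l < dim_col T \<Longrightarrow> 0 \<le> ?y $ l + (?y $ k / - edge j $ k) * edge j $ l"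
    using blocking_coordinate[of "dim_col T" ?y _ "edge j", OF y] by blast
  define t where "t = ?y $ k / - edge j $ k"
  define y' where "y' = ?y + t \<cdot>\<^sub>v edge j"
  have y': "y' \<in> carrier_vec (dim_col T)" "T *\<^sub>v y' = h"
    unfolding y'_def using move_carrier[OF basic_sol_carrier]
      move_along_edge[OF j basic_sol_carrier basic_sol_solves[OF h]] by auto
  have y'_nth: "y' $ l = ?y $ l + t * edge j $ l" if "l < dim_col T" for l
    unfolding y'_def by (rule move_nth[OF that])
  have y'_nonbasic: "y' $ l = (if l = j then t else 0)" if "l \<in> nonbasic T bs" for l
    using y'_nth[OF nonbasic_less[OF that]] that by (simp add: basic_sol_nonbasic edge_nonbasic)
  obtain i where i: "i < dim_row T" "k = bs ! i"
    using k edge_nonbasic[of k j] by (cases rule: basic_or_nonbasic[OF k(1)]) (auto split: if_splits)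
  have "a_hat T bs $$ (i, j) \<noteq> 0" using edge_basic[OF i(1) j] k(2) i(2) by simp
  note B = basis_pivot[OF i(1) j this]
  interpret P: tableau T "bs[i := j]" using B by unfold_locales
  have "y' = basic_sol (T, h) (bs[i := j])"
  proof (rule P.solution_eq_basic_sol[OF y'(1) h y'(2)])
    fix l assume "l \<in> nonbasic T (bs[i := j])"
    then have "l = k \<or> l \<in> nonbasic T bs \<and> l \<noteq> j"
      unfolding nonbasic_pivot[OF i(1) j] i(2) by blast
    then show "y' $ l = 0"
      using y'_nth[OF k(1)] k(2) y'_nonbasic by (auto simp: t_def)
  qed
  moreover have "\<forall>l<dim_col T. 0 \<le> y' $ l" using ge y'_nth by (simp add: t_def)
  ultimately have "feasible_basis T h (bs[i := j])" and y'_eq: "basic_sol (T, h) (bs[i := j]) = y'"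
    using B by (simp_all add: feasible_basis_def)
  from cheapest[OF this(1)] have "(\<Sum>k<dim_col T. d k * ?y $ k) \<le> (\<Sum>k<dim_col T. d k * y' $ k)"
    by (simp add: y'_eq)
  moreover have "(\<Sum>l\<in>nonbasic T bs. rel_cost d l * y' $ l)
      = (\<Sum>l\<in>nonbasic T bs. if l = j then rel_cost d j * t else 0)"
    by (rule sum.cong) (auto simp: y'_nonbasic)
  ultimately have "0 \<le> rel_cost d j * t"
    unfolding linear_form_eq[OF y'(1) h y'(2)] using j finite_nonbasic by simp
  moreover have "0 < t"
  proof -
    have "0 < ?y $ k" using y[OF k(1)] nondeg[OF i(1)] basic_sol_basic[OF i(1), of h] i(2) by simp
    then show ?thesis unfolding t_def using k(2) by (intro divide_pos_pos) auto
  qed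
  ultimately show False using neg by (simp add: zero_le_mult_iff)
qed

text \<open>The exponents start at \<open>1\<close> so that the perturbation vanishes at \<open>\<epsilon> = 0\<close>. Distinct variables
  get distinct powers, which keeps the contributions of different columns apart.\<close>

definition perturbation :: "nat \<Rightarrow> real \<Rightarrow> real vec" where
  "perturbation N \<epsilon> = vec N (\<lambda>j. \<epsilon> ^ Suc j)"

lemma (in tableau) b_hat_perturbed:
  assumes h: "h \<in> carrier_vec (dim_row T)" and i: "i < dim_row T"
  shows "b_hat (T, h + T *\<^sub>v perturbation (dim_col T) \<epsilon>) bs $ i =
    poly ([:b_hat (T, h) bs $ i:] + (\<Sum>j<dim_col T. monom (a_hat T bs $$ (i, j)) (Suc j))) \<epsilon>"
proof -
  let ?e = "perturbation (dim_col T) \<epsilon>"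
  have e: "?e \<in> carrier_vec (dim_col T)" by (simp add: perturbation_def)
  have TN: "T \<in> carrier_mat (dim_row T) (dim_col T)" by simp
  have "b_hat (T, h + T *\<^sub>v ?e) bs = basis_inv T bs *\<^sub>v h + basis_inv T bs *\<^sub>v (T *\<^sub>v ?e)"
    unfolding b_hat_def fst_conv snd_conv
    by (rule mult_add_distrib_mat_vec[OF basis_inv(1) h mult_mat_vec_carrier[OF TN e]])
  also have "basis_inv T bs *\<^sub>v (T *\<^sub>v ?e) = a_hat T bs *\<^sub>v ?e"
    unfolding a_hat_def by (rule assoc_mult_mat_vec[OF basis_inv(1) TN e, symmetric])
  also have "(basis_inv T bs *\<^sub>v h + a_hat T bs *\<^sub>v ?e) $ i = b_hat (T, h) bs $ i + (a_hat T bs *\<^sub>v ?e) $ i"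
    using i a_hat_carrier by (simp add: b_hat_def)
  also have "(a_hat T bs *\<^sub>v ?e) $ i = (\<Sum>j<dim_col T. a_hat T bs $$ (i, j) * ?e $ j)"
    using mult_mat_vec_nth[of i "a_hat T bs" ?e] i e a_hat_carrier by simp
  also have "\<dots> = (\<Sum>j<dim_col T. a_hat T bs $$ (i, j) * \<epsilon> ^ Suc j)"
    by (rule sum.cong) (simp_all add: perturbation_def)
  finally show ?thesis by (simp add: poly_sum poly_monom)
qed

text \<open>Column \<open>bs ! i\<close> of the tableau is a unit vector, so the power of \<open>\<epsilon>\<close> that belongs to it has
  coefficient \<open>1\<close>, and no other column uses that power.\<close>

lemma (in tableau) perturbed_row_nonzero:
  assumes i: "i < dim_row T"
  shows "[:c:] + (\<Sum>j<dim_col T. monom (a_hat T bs $$ (i, j)) (Suc j)) \<noteq> 0" (is "?q \<noteq> 0")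
proof -
  have "coeff ?q (Suc (bs ! i)) = (\<Sum>j<dim_col T. if j = bs ! i then a_hat T bs $$ (i, j) else 0)"
    by (simp add: coeff_sum)
  also have "\<dots> = 1" using basis_nth_less[OF i] a_hat_basic[OF i i] by simp
  finally show ?thesis by (metis coeff_0 zero_neq_one)
qed

lemma eventually_poly_nonzero_at_right:
  fixes q :: "real poly"
  assumes "q \<noteq> 0"
  shows "eventually (\<lambda>\<epsilon>. poly q \<epsilon> \<noteq> 0) (at_right a)"
proof -
  let ?S = "{x. poly q x = 0} - {a}"
  have "open (- ?S)" using poly_roots_finite[OF assms] by (intro open_Compl finite_imp_closed) simp
  then show ?thesis unfolding eventually_at_topological by (intro exI[of _ "- ?S"]) auto
qed

lemma finite_bases: "finite {bs. is_basis T bs}"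
  by (rule finite_subset[OF _ finite_lists_length_eq[of "{..<dim_col T}" "dim_row T"]])
    (auto simp: is_basis_def)

text \<open>Degenerate bases are the obstacle: a cheapest feasible basis may then have negative relative
  costs. Perturbing the right-hand side by \<open>T (\<epsilon>, \<epsilon>\<^sup>2, \<dots>)\<close> keeps the system feasible, and for
  all small \<open>\<epsilon> > 0\<close> it makes every basis nondegenerate, because each entry of each basic solution
  becomes a nonzero polynomial in \<open>\<epsilon>\<close>. An entry that is negative without perturbation stays
  negative for small \<open>\<epsilon>\<close>, so a cheapest feasible basis of the perturbed system is also feasible
  for the original one, and relative costs do not involve the right-hand side.\<close>

lemma exists_optimal_basis:
  assumes bs0: "is_basis T bs0" and h: "h \<in> carrier_vec (dim_row T)"
    and y: "y \<in> carrier_vec (dim_col T)" "T *\<^sub>v y = h" "\<And>k. k < dim_col T \<Longrightarrow> 0 \<le> y $ k"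
    and rec: "\<And>z. z \<in> carrier_vec (dim_col T) \<Longrightarrow> (\<And>k. k < dim_col T \<Longrightarrow> 0 \<le> z $ k)
      \<Longrightarrow> T *\<^sub>v z = 0\<^sub>v (dim_row T) \<Longrightarrow> z = 0\<^sub>v (dim_col T)"
  shows "\<exists>bs. feasible_basis T h bs \<and> (\<forall>j\<in>nonbasic T bs. 0 \<le> tableau.rel_cost T bs d j)"
proof -
  let ?N = "dim_col T" and ?M = "dim_row T"
  let ?h = "\<lambda>\<epsilon>. h + T *\<^sub>v perturbation ?N \<epsilon>"
  have ev: "eventually (\<lambda>\<epsilon>. b_hat (T, ?h \<epsilon>) bs $ i \<noteq> 0 \<and>
      (b_hat (T, h) bs $ i < 0 \<longrightarrow> b_hat (T, ?h \<epsilon>) bs $ i < 0)) (at_right 0)"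
    if bs: "is_basis T bs" and i: "i < ?M" for bs i
  proof -
    interpret tableau T bs using bs by unfold_locales
    let ?q = "[:b_hat (T, h) bs $ i:] + (\<Sum>j<?N. monom (a_hat T bs $$ (i, j)) (Suc j))"
    have "poly ?q 0 = b_hat (T, h) bs $ i" by (simp add: poly_sum poly_monom)
    moreover have "(poly ?q \<longlongrightarrow> poly ?q 0) (at_right 0)"
      by (intro tendsto_poly tendsto_ident_at)
    ultimately have "eventually (\<lambda>\<epsilon>. b_hat (T, h) bs $ i < 0 \<longrightarrow> poly ?q \<epsilon> < 0) (at_right 0)"
      using order_tendstoD(2)[of "poly ?q" "poly ?q 0" "at_right 0" 0]
      by (cases "b_hat (T, h) bs $ i < 0") auto
    moreover have "eventually (\<lambda>\<epsilon>. poly ?q \<epsilon> \<noteq> 0) (at_right 0)"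
      by (rule eventually_poly_nonzero_at_right[OF perturbed_row_nonzero[OF i]])
    ultimately show ?thesis
      unfolding b_hat_perturbed[OF h i] by eventually_elim blast
  qed
  have "eventually (\<lambda>\<epsilon>. \<forall>bs\<in>{bs. is_basis T bs}. \<forall>i\<in>{..<?M}. b_hat (T, ?h \<epsilon>) bs $ i \<noteq> 0 \<and>
      (b_hat (T, h) bs $ i < 0 \<longrightarrow> b_hat (T, ?h \<epsilon>) bs $ i < 0)) (at_right 0)"
    by (intro eventually_ball_finite finite_bases ballI finite_lessThan) (simp add: ev)
  moreover have "eventually (\<lambda>\<epsilon>. 0 < \<epsilon>) (at_right (0::real))"
    by (simp add: eventually_at_right_less)
  ultimately have "eventually (\<lambda>\<epsilon>. 0 < \<epsilon> \<and> (\<forall>bs\<in>{bs. is_basis T bs}. \<forall>i\<in>{..<?M}.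
      b_hat (T, ?h \<epsilon>) bs $ i \<noteq> 0 \<and>
      (b_hat (T, h) bs $ i < 0 \<longrightarrow> b_hat (T, ?h \<epsilon>) bs $ i < 0))) (at_right 0)"
    by eventually_elim blast
  from eventually_happens'[OF trivial_limit_at_right_real this]
  obtain \<epsilon> where \<epsilon>: "0 < \<epsilon>"
    and nondeg: "\<And>bs i. is_basis T bs \<Longrightarrow> i < ?M \<Longrightarrow> b_hat (T, ?h \<epsilon>) bs $ i \<noteq> 0"
    and neg: "\<And>bs i. is_basis T bs \<Longrightarrow> i < ?M \<Longrightarrow> b_hat (T, h) bs $ i < 0 \<Longrightarrow> b_hat (T, ?h \<epsilon>) bs $ i < 0"
    by auto
  let ?e = "perturbation ?N \<epsilon>"
  have TN: "T \<in> carrier_mat ?M ?N" by simp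
  have e: "?e \<in> carrier_vec ?N" "\<And>k. k < ?N \<Longrightarrow> 0 \<le> ?e $ k"
    using \<epsilon> by (simp_all add: perturbation_def)
  have h': "?h \<epsilon> \<in> carrier_vec ?M" using h e(1) mult_mat_vec_carrier[OF TN e(1)] by simp
  have "\<exists>bs. feasible_basis T (?h \<epsilon>) bs"
  proof (rule exists_feasible_basis[OF bs0 h', of "y + ?e"])
    show "T *\<^sub>v (y + ?e) = ?h \<epsilon>"
      unfolding mult_add_distrib_mat_vec[OF TN y(1) e(1)] y(2) ..
  qed (use y e in auto)
  moreover have "finite {bs. feasible_basis T (?h \<epsilon>) bs}"
    by (rule finite_subset[OF _ finite_bases]) (auto simp: feasible_basis_def)
  ultimately obtain bs where bs: "feasible_basis T (?h \<epsilon>) bs"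
    and cheapest: "\<And>bs'. feasible_basis T (?h \<epsilon>) bs' \<Longrightarrow> (\<Sum>k<?N. d k * basic_sol (T, ?h \<epsilon>) bs $ k)
      \<le> (\<Sum>k<?N. d k * basic_sol (T, ?h \<epsilon>) bs' $ k)"
    using ex_is_arg_min_if_finite[of "{bs. feasible_basis T (?h \<epsilon>) bs}"
      "\<lambda>bs. \<Sum>k<?N. d k * basic_sol (T, ?h \<epsilon>) bs $ k"]
    by (auto simp: is_arg_min_linorder)
  interpret tableau T bs using bs by unfold_locales (simp add: feasible_basis_def)
  have "0 \<le> basic_sol (T, h) bs $ k" if k: "k < ?N" for k
  proof (cases rule: basic_or_nonbasic[OF k])
    case (1 i)
    have "0 \<le> b_hat (T, ?h \<epsilon>) bs $ i"
      using bs k 1(2) basic_sol_basic[OF 1(1), of "?h \<epsilon>"] by (auto simp: feasible_basis_def)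
    then show ?thesis using neg[OF basis 1(1)] 1 basic_sol_basic[OF 1(1), of h] by fastforce
  qed (simp add: basic_sol_nonbasic)
  then have "feasible_basis T h bs" using basis by (simp add: feasible_basis_def)
  moreover have "\<forall>j\<in>nonbasic T bs. 0 \<le> rel_cost d j"
    using rel_cost_nonneg_if_cheapest[OF bs h' nondeg[OF basis] rec cheapest] by blast
  ultimately show ?thesis by blast
qed

section \<open>The slack variables of a node\<close>

text \<open>A row may refer to the slack variables of earlier rows but not of later ones, so the slack
  columns form a lower triangular integer matrix with \<open>\<plusminus>1\<close> on the diagonal.\<close>

definition node_shape :: "nat \<Rightarrow> node \<Rightarrow> bool" where
  "node_shape n N \<longleftrightarrow> dim_col (fst N) = n + dim_row (fst N) \<and> snd N \<in> carrier_vec (dim_row (fst N))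
    \<and> (\<forall>i<dim_row (fst N). snd N $ i \<in> \<int> \<and> (\<forall>j<dim_col (fst N). fst N $$ (i, j) \<in> \<int>)
        \<and> fst N $$ (i, n + i) \<in> {1, -1} \<and> (\<forall>k<dim_row (fst N). i < k \<longrightarrow> fst N $$ (i, n + k) = 0))"

lemma add_row_dims:
  "dim_row (fst (add_row N a \<sigma> d)) = Suc (dim_row (fst N))"
  "dim_col (fst (add_row N a \<sigma> d)) = Suc (dim_col (fst N))"
  "dim_vec (snd (add_row N a \<sigma> d)) = Suc (dim_vec (snd N))"
  by (cases N; simp)+

lemma add_row_old_entry:
  assumes "i < dim_row (fst N)" "j < Suc (dim_col (fst N))"
  shows "fst (add_row N a \<sigma> d) $$ (i, j) = (if j < dim_col (fst N) then fst N $$ (i, j) else 0)"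
  using assms by (cases N) auto

lemma add_row_new_entry:
  assumes "j < Suc (dim_col (fst N))"
  shows "fst (add_row N a \<sigma> d) $$ (dim_row (fst N), j) = (if j < dim_col (fst N) then a j else \<sigma>)"
  using assms by (cases N) auto

lemma add_row_rhs:
  "i < Suc (dim_vec (snd N)) \<Longrightarrow>
    snd (add_row N a \<sigma> d) $ i = (if i < dim_vec (snd N) then snd N $ i else d)"
  by (cases N) auto

lemma node_shape_add_row:
  assumes N: "node_shape n N" and a: "\<And>j. a j \<in> \<int>" and d: "d \<in> \<int>" and \<sigma>: "\<sigma> \<in> {1, -1}"
  shows "node_shape n (add_row N a \<sigma> d)"
proof -
  let ?M = "dim_row (fst N)" and ?N' = "add_row N a \<sigma> d"
  have dims: "dim_col (fst N) = n + ?M" "dim_vec (snd N) = ?M" using N by (auto simp: node_shape_def)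
  have old: "snd N $ i \<in> \<int>" "\<And>j. j < n + ?M \<Longrightarrow> fst N $$ (i, j) \<in> \<int>" "fst N $$ (i, n + i) \<in> {1, -1}"
    "\<And>k. k < ?M \<Longrightarrow> i < k \<Longrightarrow> fst N $$ (i, n + k) = 0" if "i < ?M" for i
    using N that unfolding node_shape_def dims by blast+
  have "\<sigma> \<in> \<int>" using \<sigma> by auto
  have "snd ?N' $ i \<in> \<int> \<and> (\<forall>j<Suc (n + ?M). fst ?N' $$ (i, j) \<in> \<int>)
      \<and> fst ?N' $$ (i, n + i) \<in> {1, -1} \<and> (\<forall>k<Suc ?M. i < k \<longrightarrow> fst ?N' $$ (i, n + k) = 0)"
    if i: "i < Suc ?M" for i
  proof (cases "i < ?M")
    case True
    have entry: "fst ?N' $$ (i, j) = (if j < n + ?M then fst N $$ (i, j) else 0)"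
      if "j < Suc (n + ?M)" for j using add_row_old_entry[of i N j] True that by (simp add: dims)
    show ?thesis
      using old[OF True] True by (simp add: entry add_row_rhs dims)
  next
    case False
    with i have i: "i = ?M" by simp
    have entry: "fst ?N' $$ (?M, j) = (if j < n + ?M then a j else \<sigma>)"
      if "j < Suc (n + ?M)" for j using add_row_new_entry[of j N] that by (simp add: dims)
    show ?thesis
      unfolding i using a d \<sigma> \<open>\<sigma> \<in> \<int>\<close> by (simp add: entry add_row_rhs dims)
  qed
  then show ?thesis
    unfolding node_shape_def add_row_dims dims by (auto intro!: carrier_vecI simp: add_row_dims dims)
qed

lemma ext_points_iff:
  "y \<in> ext_points N \<longleftrightarrow> y \<in> carrier_vec (dim_col (fst N)) \<and>
    (\<forall>k<dim_col (fst N). 0 \<le> y $ k) \<and> fst N *\<^sub>v y = snd N"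
  by (auto simp: ext_points_def less_eq_vec_def)

lemma ext_points_add_rowE:
  assumes "node_shape n N" and "y' \<in> ext_points (add_row N a \<sigma> d)"
  obtains y z where "y' = y @\<^sub>v vec 1 (\<lambda>_. z)" "y \<in> ext_points N" "0 \<le> z"
    "(\<Sum>j<dim_col (fst N). a j * y $ j) + \<sigma> * z = d"
proof -
  obtain T h where Th: "N = (T, h)" by (cases N)
  define y where "y = vec (dim_col T) (\<lambda>j. y' $ j)"
  define z where "z = y' $ dim_col T"
  have "y' \<in> carrier_vec (Suc (dim_col T))" using assms(2) by (simp add: ext_points_def Th)
  then have y': "y' = y @\<^sub>v vec 1 (\<lambda>_. z)"
    by (auto simp: y_def z_def vec_eq_iff less_Suc_eq)
  have h: "h \<in> carrier_vec (dim_row T)" using assms(1) by (simp add: node_shape_def Th)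
  have y: "y \<in> carrier_vec (dim_col T)" by (simp add: y_def)
  have "y @\<^sub>v vec 1 (\<lambda>_. z) \<in> ext_points (add_row (T, h) a \<sigma> d)"
    using assms(2) unfolding Th y' .
  then have "y \<in> ext_points N \<and> z \<ge> 0 \<and> (\<Sum>j<dim_col T. a j * y $ j) + \<sigma> * z = d"
    unfolding Th by (subst (asm) ext_points_add_row[OF _ h y]) simp_all
  with that[OF y'] show thesis by (simp add: Th)
qed

lemma ext_points_add_rowI:
  assumes "node_shape n N" and "y \<in> ext_points N" "0 \<le> z"
    "(\<Sum>j<dim_col (fst N). a j * y $ j) + \<sigma> * z = d"
  shows "y @\<^sub>v vec 1 (\<lambda>_. z) \<in> ext_points (add_row N a \<sigma> d)"
proof -
  obtain T h where Th: "N = (T, h)" by (cases N)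
  have "y \<in> carrier_vec (dim_col T)" using assms(2) by (simp add: ext_points_def Th)
  then show ?thesis
    using ext_points_add_row[of T "dim_row T" "dim_col T" h y z a \<sigma> d] assms
    by (simp add: Th node_shape_def)
qed

lemma slack_equation:
  assumes N: "node_shape n N" and y: "y \<in> carrier_vec (dim_col (fst N))" and i: "i < dim_row (fst N)"
  shows "(fst N *\<^sub>v y) $ i =
    (\<Sum>j<n + i. fst N $$ (i, j) * y $ j) + fst N $$ (i, n + i) * y $ (n + i)"
proof -
  let ?T = "fst N"
  have dim: "dim_col ?T = n + dim_row ?T"
    and zero: "\<And>k. k < dim_row ?T \<Longrightarrow> i < k \<Longrightarrow> ?T $$ (i, n + k) = 0"
    using N i by (auto simp: node_shape_def)
  have "(?T *\<^sub>v y) $ i = (\<Sum>j<dim_col ?T. ?T $$ (i, j) * y $ j)"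
    by (rule mult_mat_vec_nth[OF i y])
  also have "\<dots> = (\<Sum>j<Suc (n + i). ?T $$ (i, j) * y $ j)"
  proof (rule sum.mono_neutral_right)
    show "\<forall>j\<in>{..<dim_col ?T} - {..<Suc (n + i)}. ?T $$ (i, j) * y $ j = 0"
    proof
      fix j assume "j \<in> {..<dim_col ?T} - {..<Suc (n + i)}"
      then have "j - n < dim_row ?T" "i < j - n" "j = n + (j - n)" using dim by auto
      then show "?T $$ (i, j) * y $ j = 0" using zero[of "j - n"] by simp
    qed
  qed (use dim i in auto)
  finally show ?thesis by simp
qed

text \<open>Solving the rows from the first to the last determines one slack variable after the other.\<close>

lemma slack_vars_determined:
  assumes N: "node_shape n N" and y: "y \<in> carrier_vec (dim_col (fst N))"
    and y': "y' \<in> carrier_vec (dim_col (fst N))"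
    and eq: "fst N *\<^sub>v y = fst N *\<^sub>v y'" and orig: "\<And>j. j < n \<Longrightarrow> y $ j = y' $ j"
  shows "y = y'"
proof (rule eq_vecI)
  show "y $ k = y' $ k" if "k < dim_vec y'" for k
    using that
  proof (induction k rule: less_induct)
    case (less k)
    show ?case
    proof (cases "k < n")
      case False
      define i where "i = k - n"
      have k: "k = n + i" "i < dim_row (fst N)"
        using False less.prems N y' by (auto simp: i_def node_shape_def)
      have "(\<Sum>j<n + i. fst N $$ (i, j) * y $ j) = (\<Sum>j<n + i. fst N $$ (i, j) * y' $ j)"
        using less.IH less.prems k(1) by (intro sum.cong) auto
      with slack_equation[OF N y k(2), unfolded eq] slack_equation[OF N y' k(2)]
      have "fst N $$ (i, n + i) * y $ (n + i) = fst N $$ (i, n + i) * y' $ (n + i)" by linarith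
      moreover have "fst N $$ (i, n + i) \<noteq> 0" using N k(2) by (auto simp: node_shape_def)
      ultimately show ?thesis using k(1) by simp
    qed (simp add: orig)
  qed
qed (use y y' in simp)

text \<open>In each row the coefficient of the new slack variable is \<open>\<plusminus>1\<close>, so solving for it involves no
  division. This is where the integrality of all data enters.\<close>

lemma slack_vars_integral:
  assumes N: "node_shape n N" and y: "y \<in> carrier_vec (dim_col (fst N))"
    and eq: "fst N *\<^sub>v y = snd N" and orig: "\<And>j. j < n \<Longrightarrow> y $ j \<in> \<int>"
    and "k < dim_col (fst N)"
  shows "y $ k \<in> \<int>"
  using assms(5)
proof (induction k rule: less_induct)
  case (less k)
  show ?case
  proof (cases "k < n")
    case False
    define i where "i = k - n"
    have k: "k = n + i" "i < dim_row (fst N)"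
      using False less.prems N by (auto simp: i_def node_shape_def)
    let ?s = "fst N $$ (i, n + i)"
    have "snd N $ i \<in> \<int>" "\<And>j. j < dim_col (fst N) \<Longrightarrow> fst N $$ (i, j) \<in> \<int>" and s: "?s \<in> {1, -1}"
      using N k(2) by (auto simp: node_shape_def)
    moreover from this(2) have "(\<Sum>j<n + i. fst N $$ (i, j) * y $ j) \<in> \<int>"
      using less.IH less.prems k(1) by (intro Ints_sum Ints_mult) auto
    ultimately have "snd N $ i - (\<Sum>j<n + i. fst N $$ (i, j) * y $ j) \<in> \<int>" by (intro Ints_diff)
    then have "?s * y $ k \<in> \<int>" using slack_equation[OF N y k(2)] k(1) by (simp add: eq)
    with s show ?thesis by auto
  qed (simp add: orig)
qed

lemma slack_basis:
  assumes N: "node_shape n N"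
  shows "is_basis (fst N) [n..<n + dim_row (fst N)]"
proof (rule is_basisI)
  have dim: "dim_col (fst N) = n + dim_row (fst N)" using N by (simp add: node_shape_def)
  then show "set [n..<n + dim_row (fst N)] \<subseteq> {..<dim_col (fst N)}" by auto
  fix z :: "real vec"
  assume z: "z \<in> carrier_vec (dim_col (fst N))" "fst N *\<^sub>v z = 0\<^sub>v (dim_row (fst N))"
    and nb: "\<And>j. j \<in> nonbasic (fst N) [n..<n + dim_row (fst N)] \<Longrightarrow> z $ j = 0"
  have "z $ j = 0" if "j < n" for j using that dim by (intro nb) (simp add: nonbasic_def)
  then have "z $ j = 0\<^sub>v (dim_col (fst N)) $ j" if "j < n" for j using that dim by simp
  moreover have "fst N *\<^sub>v 0\<^sub>v (dim_col (fst N)) = 0\<^sub>v (dim_row (fst N))" by (rule eq_vecI) auto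
  then have "fst N *\<^sub>v z = fst N *\<^sub>v 0\<^sub>v (dim_col (fst N))" by (simp only: z(2))
  ultimately show "z = 0\<^sub>v (dim_col (fst N))"
    by (rule slack_vars_determined[OF N z(1) zero_carrier_vec, rotated])
qed auto

section \<open>Linear forms on a node\<close>

context blf_data
begin

definition valid_node :: "node \<Rightarrow> bool" where
  "valid_node N \<longleftrightarrow> node_shape n N \<and> node_poly N \<subseteq> X"

lemma dim_col_ge: "node_shape n N \<Longrightarrow> n \<le> dim_col (fst N)"
  by (simp add: node_shape_def)

lemma node_poly_add_row:
  assumes N: "node_shape n N"
  shows "x \<in> node_poly (add_row N a \<sigma> d) \<longleftrightarrow> (\<exists>y\<in>ext_points N. x = vec_first y n \<and>
    (\<exists>z\<ge>0. (\<Sum>j<dim_col (fst N). a j * y $ j) + \<sigma> * z = d))"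
proof -
  have first: "vec_first (y @\<^sub>v v) n = vec_first y n" if "y \<in> ext_points N" for y v
    using that dim_col_ge[OF N] by (auto simp: vec_first_def vec_eq_iff ext_points_def)
  show ?thesis
  proof
    assume "x \<in> node_poly (add_row N a \<sigma> d)"
    then obtain y' where y': "y' \<in> ext_points (add_row N a \<sigma> d)" "x = vec_first y' n"
      by (auto simp: node_poly_def)
    from ext_points_add_rowE[OF N y'(1)] obtain y z where "y' = y @\<^sub>v vec 1 (\<lambda>_. z)" "y \<in> ext_points N"
      "0 \<le> z" "(\<Sum>j<dim_col (fst N). a j * y $ j) + \<sigma> * z = d" .
    with y'(2) show "\<exists>y\<in>ext_points N. x = vec_first y n \<and>
      (\<exists>z\<ge>0. (\<Sum>j<dim_col (fst N). a j * y $ j) + \<sigma> * z = d)" using first by blast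
  next
    assume "\<exists>y\<in>ext_points N. x = vec_first y n \<and>
      (\<exists>z\<ge>0. (\<Sum>j<dim_col (fst N). a j * y $ j) + \<sigma> * z = d)"
    then obtain y z where yz: "y \<in> ext_points N" "x = vec_first y n" "0 \<le> z"
      "(\<Sum>j<dim_col (fst N). a j * y $ j) + \<sigma> * z = d" by blast
    from ext_points_add_rowI[OF N yz(1,3,4)] first[OF yz(1)] yz(2)
    show "x \<in> node_poly (add_row N a \<sigma> d)" unfolding node_poly_def by (metis image_eqI)
  qed
qed

lemma node_poly_add_le:
  assumes "node_shape n N"
  shows "node_poly (add_le N a d) =
    {vec_first y n | y. y \<in> ext_points N \<and> (\<Sum>j<dim_col (fst N). a j * y $ j) \<le> d}"
proof -
  have "(\<exists>z\<ge>0. s + 1 * z = d) \<longleftrightarrow> s \<le> d" for s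
    by (metis add_le_cancel_left add.right_neutral diff_add_cancel diff_ge_0_iff_ge add.commute mult_1)
  then show ?thesis unfolding add_le_def using node_poly_add_row[OF assms] by blast
qed

lemma node_poly_add_ge:
  assumes "node_shape n N"
  shows "node_poly (add_ge N a d) =
    {vec_first y n | y. y \<in> ext_points N \<and> d \<le> (\<Sum>j<dim_col (fst N). a j * y $ j)}"
proof -
  have "(\<exists>z\<ge>0. s + -1 * z = d) \<longleftrightarrow> d \<le> s" for s
  proof
    assume "d \<le> s"
    then show "\<exists>z\<ge>0. s + -1 * z = d" by (intro exI[of _ "s - d"]) simp
  qed auto
  then show ?thesis unfolding add_ge_def using node_poly_add_row[OF assms] by blast
qed

lemma scalar_prod_eq_cost_sum:
  assumes N: "node_shape n N" and v: "v \<in> carrier_vec n" and y: "y \<in> carrier_vec (dim_col (fst N))"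
  shows "v \<bullet> vec_first y n = (\<Sum>k<dim_col (fst N). cost v k * y $ k)"
proof -
  have "v \<bullet> vec_first y n = (\<Sum>k<n. v $ k * y $ k)"
    by (auto simp: scalar_prod_def vec_first_def lessThan_atLeast0 intro!: sum.cong)
  also have "\<dots> = (\<Sum>k<n. cost v k * y $ k)" by (rule sum.cong) (simp_all add: cost_def)
  also have "\<dots> = (\<Sum>k<dim_col (fst N). cost v k * y $ k)"
    using dim_col_ge[OF N] by (intro sum.mono_neutral_left) (auto simp: cost_def)
  finally show ?thesis .
qed

lemma reduced_cost_eq_rel_cost:
  assumes "is_basis (fst N) bs" and j: "j < dim_col (fst N)"
  shows "reduced_cost v N bs j = tableau.rel_cost (fst N) bs (cost v) j"
proof -
  interpret tableau "fst N" bs using assms(1) by unfold_locales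
  have C: "basis_inv (fst N) bs \<in> carrier_mat (dim_row (fst N)) (dim_row (fst N))" by (rule basis_inv(1))
  have "basis_inv (fst N) bs *\<^sub>v col (fst N) j = col (a_hat (fst N) bs) j"
    unfolding a_hat_def using j by (intro col_mult2[OF C, symmetric]) auto
  then have "vec (length bs) (\<lambda>i. cost v (bs ! i)) \<bullet> (basis_inv (fst N) bs *\<^sub>v col (fst N) j) =
    (\<Sum>i<dim_row (fst N). cost v (bs ! i) * a_hat (fst N) bs $$ (i, j))"
    using a_hat_carrier j
    by (auto simp: scalar_prod_def length_basis lessThan_atLeast0 intro!: sum.cong)
  then show ?thesis by (simp add: reduced_cost_def rel_cost_def)
qed

lemma f_bar_eq_reduced_cost:
  assumes "is_basis (fst N) bs" and j: "j < dim_col (fst N)"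
  shows "f_bar N bs i j = reduced_cost (grad_f i (node_sol N bs)) N bs j"
proof -
  interpret tableau "fst N" bs using assms(1) by unfold_locales
  let ?g = "grad_f i (node_sol N bs)"
  have "(\<Sum>k \<in> set bs \<inter> {..<n}. ?g $ k * a_hat (fst N) bs $$ (row_of bs k, j))
    = (\<Sum>k \<in> set bs. cost ?g k * a_hat (fst N) bs $$ (row_of bs k, j))"
    by (rule sum.mono_neutral_cong_left) (auto simp: cost_def)
  also have "\<dots> = (\<Sum>i<dim_row (fst N). cost ?g (bs ! i) * a_hat (fst N) bs $$ (row_of bs (bs ! i), j))"
    using sum_nth_eq_sum_set[OF distinct_basis,
      of "\<lambda>k. cost ?g k * a_hat (fst N) bs $$ (row_of bs k, j)"] by (simp add: length_basis)
  also have "\<dots> = (\<Sum>i<dim_row (fst N). cost ?g (bs ! i) * a_hat (fst N) bs $$ (i, j))"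
    by (rule sum.cong) (simp_all add: row_of_nth[OF distinct_basis] length_basis)
  finally show ?thesis
    unfolding reduced_cost_eq_rel_cost[OF assms] f_bar_def rel_cost_def by (simp add: cost_def)
qed

lemma linear_form_via_reduced_cost:
  assumes N: "node_shape n N" and bs: "is_basis (fst N) bs" and v: "v \<in> carrier_vec n"
    and y: "y \<in> ext_points N"
  shows "v \<bullet> vec_first y n = v \<bullet> node_sol N bs + (\<Sum>j\<in>nonbasic (fst N) bs. reduced_cost v N bs j * y $ j)"
proof -
  interpret tableau "fst N" bs using bs by unfold_locales
  have h: "snd N \<in> carrier_vec (dim_row (fst N))" using N by (simp add: node_shape_def)
  have yc: "y \<in> carrier_vec (dim_col (fst N))" and sol: "fst N *\<^sub>v y = snd N"
    using y by (simp_all add: ext_points_def)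
  have bsol: "basic_sol N bs \<in> carrier_vec (dim_col (fst N))" by (simp add: basic_sol_def)
  have "(\<Sum>j\<in>nonbasic (fst N) bs. reduced_cost v N bs j * y $ j)
    = (\<Sum>j\<in>nonbasic (fst N) bs. rel_cost (cost v) j * y $ j)"
    by (rule sum.cong) (simp_all add: reduced_cost_eq_rel_cost[OF bs] nonbasic_def)
  then show ?thesis
    using linear_form_eq[OF yc h sol, of "cost v"]
    by (simp add: scalar_prod_eq_cost_sum[OF N v yc] node_sol_def scalar_prod_eq_cost_sum[OF N v bsol])
qed

lemma point_eq_node_sol:
  assumes N: "node_shape n N" and bs: "is_basis (fst N) bs" and y: "y \<in> ext_points N"
    and zero: "\<And>j. j \<in> nonbasic (fst N) bs \<Longrightarrow> y $ j = 0"
  shows "vec_first y n = node_sol N bs"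
proof -
  interpret tableau "fst N" bs using bs by unfold_locales
  have "y = basic_sol (fst N, snd N) bs"
    using N y zero by (intro solution_eq_basic_sol) (auto simp: node_shape_def ext_points_def)
  then show ?thesis by (simp add: node_sol_def)
qed

text \<open>The slack variables cannot differ from those of the basic solution, so cutting off the basic
  solution in the extended space also cuts off its projection.\<close>

lemma ext_point_of_node_sol:
  assumes N: "node_shape n N" and opt: "optimal_tableau N bs" and y: "y \<in> ext_points N"
    and "vec_first y n = node_sol N bs"
  shows "y = basic_sol N bs"
proof (rule slack_vars_determined[OF N])
  show "y $ j = basic_sol N bs $ j" if "j < n" for j
    using assms(4) that unfolding node_sol_def vec_first_def vec_eq_iff by simp
qed (use y opt in \<open>auto simp: ext_points_def optimal_tableau_def\<close>)

lemma node_sol_in_node_poly: "optimal_tableau N bs \<Longrightarrow> node_sol N bs \<in> node_poly N"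
  by (simp add: optimal_tableau_def node_sol_def node_poly_def)

lemma ext_point_integral:
  assumes N: "node_shape n N" and y: "y \<in> ext_points N" and "vec_first y n \<in> D"
    and "k < dim_col (fst N)"
  shows "y $ k \<in> \<int>"
proof (rule slack_vars_integral[OF N _ _ _ assms(4)])
  show "y $ j \<in> \<int>" if "j < n" for j
    using assms(3) that by (auto simp: D_def vec_first_def)
qed (use y in \<open>simp_all add: ext_points_iff\<close>)

lemma ext_point_nonneg: "y \<in> ext_points N \<Longrightarrow> k < dim_col (fst N) \<Longrightarrow> 0 \<le> y $ k"
  by (simp add: ext_points_iff)

text \<open>Nonnegative integers whose sum is less than \<open>1\<close> are all \<open>0\<close>.\<close>

lemma zero_if_cut_violated:
  assumes N: "node_shape n N" and y: "y \<in> ext_points N" and D: "vec_first y n \<in> D"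
    and J: "J \<subseteq> {..<dim_col (fst N)}" and small: "(\<Sum>j\<in>J. y $ j) < 1" and j: "j \<in> J"
  shows "y $ j = 0"
proof -
  have "finite J" using J by (rule finite_subset) simp
  then have "y $ j \<le> (\<Sum>j\<in>J. y $ j)"
    using J ext_point_nonneg[OF y] j by (intro member_le_sum) auto
  then have "y $ j < 1" using small by simp
  moreover have "0 \<le> y $ j" "y $ j \<in> \<int>"
    using J j ext_point_nonneg[OF y] ext_point_integral[OF N y D] by auto
  ultimately show ?thesis by (auto elim!: Ints_cases)
qed

end

context blf_moiqp
begin

lemma grad_f_carrier: "i \<in> {1..r} \<Longrightarrow> grad_f i x \<in> carrier_vec n"
  unfolding grad_f_def using c_dim[of i] by (intro carrier_vecI) simp

text \<open>By symmetry of \<open>Q i\<close>, twice the gap between the two sides is the value of its quadratic form at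
  \<open>x - x0\<close>, which is nonnegative.\<close>

lemma f_ge_linearization:
  assumes i: "i \<in> {1..r}" and x: "x \<in> carrier_vec n" and x0: "x0 \<in> carrier_vec n"
  shows "f i x0 + (grad_f i x0 \<bullet> x - grad_f i x0 \<bullet> x0) \<le> f i x"
proof -
  define R where "R = map_mat real_of_int (Q i)"
  define d where "d = map_vec real_of_int (c i)"
  have R: "R \<in> carrier_mat n n" and d: "d \<in> carrier_vec n"
    using Q_dim[OF i] c_dim[OF i] by (auto simp: R_def d_def)
  have "transpose_mat R = map_mat real_of_int (transpose_mat (Q i))"
    unfolding R_def by (rule eq_matI) auto
  then have sym: "transpose_mat R = R" unfolding Q_sym[OF i] R_def .
  have Rc: "R *\<^sub>v v \<in> carrier_vec n" if "v \<in> carrier_vec n" for v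
    using mult_mat_vec_carrier[OF R that] .
  have "0 \<le> (x - x0) \<bullet> (R *\<^sub>v (x - x0))"
    using Q_psd[OF i, of "x - x0"] x x0 by (simp add: R_def)
  also have "R *\<^sub>v (x - x0) = R *\<^sub>v x - R *\<^sub>v x0" by (rule mult_minus_distrib_mat_vec[OF R x x0])
  also have "(x - x0) \<bullet> (R *\<^sub>v x - R *\<^sub>v x0) = x \<bullet> (R *\<^sub>v x) - x \<bullet> (R *\<^sub>v x0)
      - (x0 \<bullet> (R *\<^sub>v x) - x0 \<bullet> (R *\<^sub>v x0))"
    using x x0 Rc[OF x] Rc[OF x0]
    by (simp add: minus_scalar_prod_distrib[of _ n] scalar_prod_minus_distrib[of _ n])
  also have "x0 \<bullet> (R *\<^sub>v x) = (R *\<^sub>v x0) \<bullet> x"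
    using transpose_vec_mult_scalar[OF R x x0] sym by simp
  also have "(R *\<^sub>v x0) \<bullet> x = x \<bullet> (R *\<^sub>v x0)" by (rule comm_scalar_prod[OF Rc[OF x0] x])
  finally have "0 \<le> x \<bullet> (R *\<^sub>v x) - 2 * (x \<bullet> (R *\<^sub>v x0)) + x0 \<bullet> (R *\<^sub>v x0)" by simp
  moreover have "grad_f i x0 \<bullet> v = v \<bullet> (R *\<^sub>v x0) + d \<bullet> v" if v: "v \<in> carrier_vec n" for v
    unfolding grad_f_def R_def[symmetric] d_def[symmetric] add_scalar_prod_distrib[OF Rc[OF x0] d v]
    by (simp add: comm_scalar_prod[OF Rc[OF x0] v])
  ultimately show ?thesis
    unfolding f_def R_def[symmetric] d_def[symmetric] using x x0 by simp
qed

lemma root_valid: "valid_node root"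
proof -
  have "node_shape n root"
    using A_dim b_dim unfolding node_shape_def root_def by auto
  then show ?thesis using node_poly_root[OF A_dim b_dim] by (simp add: valid_node_def)
qed

end

section \<open>Optimal tableaus and validity of the cuts\<close>

context blf_moiqp
begin

text \<open>Any multiple of a recession direction can be added to a point of the node. Boundedness of \<open>X\<close>
  annihilates its original variables, and these determine the slack variables.\<close>

lemma trivial_recession:
  assumes N: "valid_node N" and ne: "node_poly N \<noteq> {}"
    and z: "z \<in> carrier_vec (dim_col (fst N))" "\<And>k. k < dim_col (fst N) \<Longrightarrow> 0 \<le> z $ k"
      "fst N *\<^sub>v z = 0\<^sub>v (dim_row (fst N))"
  shows "z = 0\<^sub>v (dim_col (fst N))"
proof -
  have shape: "node_shape n N" and X: "node_poly N \<subseteq> X" using N by (simp_all add: valid_node_def)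
  have TN: "fst N \<in> carrier_mat (dim_row (fst N)) (dim_col (fst N))" by simp
  have h: "snd N \<in> carrier_vec (dim_row (fst N))" using shape by (simp add: node_shape_def)
  obtain y where y: "y \<in> ext_points N" using ne by (auto simp: node_poly_def)
  have yc: "y \<in> carrier_vec (dim_col (fst N))" and ysol: "fst N *\<^sub>v y = snd N"
    using y by (simp_all add: ext_points_iff)
  obtain K where K: "\<And>x k. x \<in> X \<Longrightarrow> k < n \<Longrightarrow> \<bar>x $ k\<bar> \<le> K" using X_bounded by blast
  have zero: "z $ k = 0" if k: "k < n" for k
  proof (rule ccontr)
    assume "z $ k \<noteq> 0"
    have kN: "k < dim_col (fst N)" using k dim_col_ge[OF shape] by simp
    with z(2) \<open>z $ k \<noteq> 0\<close> have pos: "0 < z $ k" by fastforce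
    have bound: "\<bar>y $ k + t * z $ k\<bar> \<le> K" if t: "0 \<le> t" for t
    proof -
      have "fst N *\<^sub>v (y + t \<cdot>\<^sub>v z) = fst N *\<^sub>v y + t \<cdot>\<^sub>v (fst N *\<^sub>v z)"
        using yc z(1) by (simp add: mult_add_distrib_mat_vec[OF TN] mult_mat_vec[OF TN])
      also have "\<dots> = snd N" unfolding ysol z(3) using h by auto
      finally have "y + t \<cdot>\<^sub>v z \<in> ext_points N"
        using yc z(1,2) t ext_point_nonneg[OF y] by (simp add: ext_points_iff)
      then have "vec_first (y + t \<cdot>\<^sub>v z) n \<in> X" using X by (auto simp: node_poly_def)
      from K[OF this k] show ?thesis using k kN yc z(1) by (simp add: vec_first_def)
    qed
    have "0 \<le> K" using bound[of 0] by simp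
    then have "\<bar>y $ k + (K + 1)\<bar> \<le> K" using bound[of "(K + 1) / z $ k"] pos by simp
    moreover have "0 \<le> y $ k" by (rule ext_point_nonneg[OF y kN])
    ultimately show False by simp
  qed
  have "fst N *\<^sub>v z = fst N *\<^sub>v 0\<^sub>v (dim_col (fst N))"
    unfolding z(3) by (rule eq_vecI) auto
  moreover have "z $ k = 0\<^sub>v (dim_col (fst N)) $ k" if "k < n" for k
    using zero[OF that] that dim_col_ge[OF shape] by simp
  ultimately show ?thesis
    by (rule slack_vars_determined[OF shape z(1) zero_carrier_vec])
qed

lemma feasible_basis_iff:
  assumes N: "node_shape n N"
  shows "feasible_basis (fst N) (snd N) bs \<longleftrightarrow> is_basis (fst N) bs \<and> basic_sol N bs \<in> ext_points N"
proof (cases "is_basis (fst N) bs")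
  case True
  interpret tableau "fst N" bs using True by unfold_locales
  have h: "snd N \<in> carrier_vec (dim_row (fst N))" using N by (simp add: node_shape_def)
  show ?thesis
    using True basic_sol_solves[OF h] basic_sol_carrier[of "snd N"]
    by (simp add: feasible_basis_def ext_points_iff)
qed (simp add: feasible_basis_def)

text \<open>For the optimal value \<open>v\<close>, minimizing the ratio is the same as minimizing the linear form
  \<open>numer - v * denom\<close>, whose minimum is \<open>0\<close> and whose relative costs are those of the ratio
  up to a positive factor. That \<open>v\<close> is attained at a basic solution first makes it available.\<close>

lemma exists_optimal_tableau:
  assumes N: "valid_node N" and ne: "node_poly N \<noteq> {}"
  shows "\<exists>bs. optimal_tableau N bs"
proof -
  have shape: "node_shape n N" and X: "node_poly N \<subseteq> X" using N by (simp_all add: valid_node_def)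
  have h: "snd N \<in> carrier_vec (dim_row (fst N))" using shape by (simp add: node_shape_def)
  obtain y where y: "y \<in> ext_points N" using ne by (auto simp: node_poly_def)
  have yc: "y \<in> carrier_vec (dim_col (fst N))" and ysol: "fst N *\<^sub>v y = snd N"
    using y by (simp_all add: ext_points_iff)
  let ?feas = "\<lambda>bs. is_basis (fst N) bs \<and> basic_sol N bs \<in> ext_points N"
  have sol: "node_sol N bs \<in> node_poly N" if "?feas bs" for bs
    using that by (simp add: node_sol_def node_poly_def)
  have denom: "0 < denom 1 x" if "x \<in> node_poly N" for x using denom_pos[of 1 x] that X by auto
  have "\<exists>bs. feasible_basis (fst N) (snd N) bs"
    by (rule exists_feasible_basis[OF slack_basis[OF shape] h yc ysol ext_point_nonneg[OF y]])
  then have "{bs. ?feas bs} \<noteq> {}" unfolding feasible_basis_iff[OF shape] by blast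
  moreover have "finite {bs. ?feas bs}" by (rule finite_subset[OF _ finite_bases]) blast
  ultimately obtain bs0 where bs0: "?feas bs0"
    and min: "\<And>bs. ?feas bs \<Longrightarrow> \<psi> 1 (node_sol N bs0) \<le> \<psi> 1 (node_sol N bs)"
    using ex_is_arg_min_if_finite[of "{bs. ?feas bs}" "\<lambda>bs. \<psi> 1 (node_sol N bs)"]
    unfolding is_arg_min_linorder by blast
  define v where "v = \<psi> 1 (node_sol N bs0)"
  define g where "g = (\<lambda>x. numer 1 x - v * denom 1 x)"
  let ?d = "\<lambda>k. cost (p 1) k - v * cost (q 1) k"
  have pq: "p 1 \<in> carrier_vec n" "q 1 \<in> carrier_vec n" using p_dim[of 1] q_dim[of 1] by auto
  have "\<exists>bs. feasible_basis (fst N) (snd N) bs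
      \<and> (\<forall>j\<in>nonbasic (fst N) bs. 0 \<le> tableau.rel_cost (fst N) bs ?d j)"
    by (rule exists_optimal_basis[OF slack_basis[OF shape] h yc ysol ext_point_nonneg[OF y]
      trivial_recession[OF N ne]])
  then obtain bs where bs: "?feas bs"
    and rel: "\<And>j. j \<in> nonbasic (fst N) bs \<Longrightarrow> 0 \<le> tableau.rel_cost (fst N) bs ?d j"
    unfolding feasible_basis_iff[OF shape] by blast
  interpret tableau "fst N" bs using bs by unfold_locales blast
  have red: "0 \<le> \<eta> N bs 1 j - v * \<theta> N bs 1 j" if j: "j \<in> nonbasic (fst N) bs" for j
  proof -
    have "rel_cost ?d j = rel_cost (cost (p 1)) j - v * rel_cost (cost (q 1)) j"
      by (simp add: rel_cost_def left_diff_distrib right_diff_distrib sum_subtractf sum_distrib_left mult.assoc)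
    then show ?thesis using rel[OF j] nonbasic_less[OF j]
      by (simp add: \<eta>_def \<theta>_def reduced_cost_eq_rel_cost[OF basis])
  qed
  let ?x = "node_sol N bs"
  have g_ge: "g ?x \<le> g x" if x: "x \<in> node_poly N" for x
  proof -
    obtain y where y: "y \<in> ext_points N" "x = vec_first y n" using x by (auto simp: node_poly_def)
    let ?s = "\<lambda>u. \<Sum>j\<in>nonbasic (fst N) bs. reduced_cost u N bs j * y $ j"
    have "0 \<le> (\<Sum>j\<in>nonbasic (fst N) bs. (\<eta> N bs 1 j - v * \<theta> N bs 1 j) * y $ j)"
      by (intro sum_nonneg mult_nonneg_nonneg red ext_point_nonneg[OF y(1)] nonbasic_less)
    also have "\<dots> = ?s (p 1) - v * ?s (q 1)"
      by (simp add: \<eta>_def \<theta>_def left_diff_distrib sum_subtractf sum_distrib_left mult.assoc)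
    finally show ?thesis
      using linear_form_via_reduced_cost[OF shape basis pq(1) y(1)]
        linear_form_via_reduced_cost[OF shape basis pq(2) y(1)]
      by (simp add: g_def numer_def denom_def y(2) algebra_simps)
  qed
  have g_iff: "g x \<le> 0 \<longleftrightarrow> \<psi> 1 x \<le> v" "0 \<le> g x \<longleftrightarrow> v \<le> \<psi> 1 x" if "x \<in> node_poly N" for x
    using denom[OF that] by (simp_all add: g_def \<psi>_def divide_le_eq le_divide_eq)
  have "g (node_sol N bs0) \<le> 0" using g_iff(1)[OF sol[OF bs0]] by (simp add: v_def)
  with g_ge[OF sol[OF bs0]] have "g ?x \<le> 0" by simp
  moreover have "0 \<le> g ?x" using g_iff(2)[OF sol[OF bs]] min[OF bs] by (simp add: v_def)
  ultimately have g0: "g ?x = 0" by simp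
  have "\<forall>x\<in>node_poly N. \<psi> 1 ?x \<le> \<psi> 1 x"
  proof
    fix x assume x: "x \<in> node_poly N"
    have "\<psi> 1 ?x \<le> v" using g_iff(1)[OF sol[OF bs]] g0 by simp
    also have "v \<le> \<psi> 1 x" using g_iff(2)[OF x] g_ge[OF x] g0 by simp
    finally show "\<psi> 1 ?x \<le> \<psi> 1 x" .
  qed
  moreover have "\<forall>j\<in>nonbasic (fst N) bs. 0 \<le> \<gamma> N bs 1 j"
  proof
    fix j assume j: "j \<in> nonbasic (fst N) bs"
    have "numer 1 ?x = v * denom 1 ?x" using g0 by (simp add: g_def)
    then have "\<gamma> N bs 1 j = denom 1 ?x * (\<eta> N bs 1 j - v * \<theta> N bs 1 j)"
      by (simp add: \<gamma>_def algebra_simps)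
    then show "0 \<le> \<gamma> N bs 1 j"
      using denom[OF sol[OF bs]] red[OF j] by (simp add: mult_nonneg_nonneg)
  qed
  ultimately show ?thesis using bs unfolding optimal_tableau_def by blast
qed

lemma exists_positive_nonbasic:
  assumes N: "node_shape n N" and opt: "optimal_tableau N bs" and y: "y \<in> ext_points N"
    and ne: "vec_first y n \<noteq> node_sol N bs"
  obtains j where "j \<in> nonbasic (fst N) bs" "0 < y $ j"
proof -
  have bs: "is_basis (fst N) bs" using opt by (simp add: optimal_tableau_def)
  obtain j where j: "j \<in> nonbasic (fst N) bs" "y $ j \<noteq> 0"
    using point_eq_node_sol[OF N bs y] ne by blast
  moreover have "0 \<le> y $ j" using ext_point_nonneg[OF y] j(1) by (simp add: nonbasic_def)
  ultimately show thesis by (intro that) auto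
qed

lemma node_sol_in_D:
  "valid_node N \<Longrightarrow> optimal_tableau N bs \<Longrightarrow> integral (node_sol N bs) \<Longrightarrow> node_sol N bs \<in> D"
  using node_sol_in_node_poly[of N bs] by (auto simp: D_def integral_def valid_node_def)

text \<open>Were the cut violated, the variables of \<open>H\<close> would vanish at the point. Some nonbasic variable
  is positive there, since the point is not the basic solution, and for the variables outside \<open>H\<close> the reduced
  gradients are nonnegative and not all zero. By convexity the basic solution would then dominate
  the point.\<close>

lemma efficient_satisfies_H_cut:
  assumes N: "valid_node N" and opt: "optimal_tableau N bs" and int: "integral (node_sol N bs)"
    and y: "y \<in> ext_points N" and eff: "vec_first y n \<in> X_Q" and ne: "vec_first y n \<noteq> node_sol N bs"
  shows "1 \<le> (\<Sum>j\<in>H N bs. y $ j)"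
proof (rule ccontr)
  assume "\<not> ?thesis"
  then have small: "(\<Sum>j\<in>H N bs. y $ j) < 1" by simp
  let ?base = "node_sol N bs" and ?x = "vec_first y n" and ?NB = "nonbasic (fst N) bs"
  have shape: "node_shape n N" using N by (simp add: valid_node_def)
  have bs: "is_basis (fst N) bs" using opt by (simp add: optimal_tableau_def)
  have xD: "?x \<in> D" using eff by (simp add: X_Q_def efficient_set_def)
  have HN: "H N bs \<subseteq> ?NB" by (auto simp: H_def)
  then have "H N bs \<subseteq> {..<dim_col (fst N)}" by (auto simp: nonbasic_def)
  note zero = zero_if_cut_violated[OF shape y xD this small]
  have y0: "0 \<le> y $ j" if "j \<in> ?NB" for j using that ext_point_nonneg[OF y] by (simp add: nonbasic_def)
  have terms: "0 \<le> f_bar N bs i j * y $ j" if i: "i \<in> {1..r}" and j: "j \<in> ?NB" for i j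
  proof (cases "j \<in> H N bs")
    case False
    then have "0 \<le> f_bar N bs i j" using i j by (force simp: H_def)
    then show ?thesis using y0[OF j] by (rule mult_nonneg_nonneg)
  qed (simp add: zero)
  have growth: "f i ?base + (\<Sum>j\<in>?NB. f_bar N bs i j * y $ j) \<le> f i ?x" if i: "i \<in> {1..r}" for i
  proof -
    have "(\<Sum>j\<in>?NB. f_bar N bs i j * y $ j) = (\<Sum>j\<in>?NB. reduced_cost (grad_f i ?base) N bs j * y $ j)"
      by (rule sum.cong) (simp_all add: f_bar_eq_reduced_cost[OF bs] nonbasic_def)
    then show ?thesis
      using f_ge_linearization[OF i, of ?x ?base]
        linear_form_via_reduced_cost[OF shape bs grad_f_carrier[OF i] y, of ?base]
      by (simp add: node_sol_def)
  qed
  have le: "f i ?base \<le> f i ?x" if i: "i \<in> {1..r}" for i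
  proof -
    have "0 \<le> (\<Sum>j\<in>?NB. f_bar N bs i j * y $ j)" by (rule sum_nonneg) (rule terms[OF i])
    then show ?thesis using growth[OF i] by linarith
  qed
  obtain j where j: "j \<in> ?NB" "0 < y $ j" by (rule exists_positive_nonbasic[OF shape opt y ne])
  then have "j \<notin> H N bs" using zero by fastforce
  then obtain i where i: "i \<in> {1..r}" "0 < f_bar N bs i j"
    using j(1) by (force simp: H_def)
  have "0 < (\<Sum>j\<in>?NB. f_bar N bs i j * y $ j)"
    by (rule sum_pos2[OF _ j(1)]) (use i j terms in \<open>auto simp: nonbasic_def\<close>)
  then have "f i ?base < f i ?x" using growth[OF i(1)] by linarith
  with le i(1) node_sol_in_D[OF N opt int] eff show False
    unfolding X_Q_def efficient_set_def by blast
qed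

text \<open>The same argument, with an exact expression for the growth of the ratios in place of convexity.
  Raising a nonbasic variable outside \<open>H'\<close> decreases neither ratio and increases at least one, because
  \<open>\<gamma> N bs 1\<close> is nonnegative at an optimal tableau.\<close>

lemma efficient_satisfies_H'_cut:
  assumes N: "valid_node N" and opt: "optimal_tableau N bs" and int: "integral (node_sol N bs)"
    and y: "y \<in> ext_points N" and eff: "vec_first y n \<in> X_F" and ne: "vec_first y n \<noteq> node_sol N bs"
  shows "1 \<le> (\<Sum>j\<in>H' N bs. y $ j)"
proof (rule ccontr)
  assume "\<not> ?thesis"
  then have small: "(\<Sum>j\<in>H' N bs. y $ j) < 1" by simp
  let ?base = "node_sol N bs" and ?x = "vec_first y n" and ?NB = "nonbasic (fst N) bs"
  have shape: "node_shape n N" and X: "node_poly N \<subseteq> X" using N by (simp_all add: valid_node_def)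
  have bs: "is_basis (fst N) bs" and opt1: "\<And>j. j \<in> ?NB \<Longrightarrow> 0 \<le> \<gamma> N bs 1 j"
    using opt by (simp_all add: optimal_tableau_def)
  have xD: "?x \<in> D" using eff by (simp add: X_F_def efficient_set_def)
  have HN: "H' N bs \<subseteq> ?NB" by (auto simp: H'_def)
  then have "H' N bs \<subseteq> {..<dim_col (fst N)}" by (auto simp: nonbasic_def)
  note zero = zero_if_cut_violated[OF shape y xD this small]
  have y0: "0 \<le> y $ j" if "j \<in> ?NB" for j using that ext_point_nonneg[OF y] by (simp add: nonbasic_def)
  have terms: "0 \<le> \<gamma> N bs s j * y $ j" if s: "s \<in> {1, 2}" and j: "j \<in> ?NB" for s j
  proof (cases "j \<in> H' N bs")
    case False
    then have "0 \<le> \<gamma> N bs s j" using s j opt1[OF j] by (force simp: H'_def)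
    then show ?thesis using y0[OF j] by (rule mult_nonneg_nonneg)
  qed (simp add: zero)
  have x0X: "?base \<in> X" using node_sol_in_node_poly[OF opt] X by blast
  have xX: "?x \<in> X" using xD by (simp add: D_def)
  have diff: "\<psi> s ?x - \<psi> s ?base = (\<Sum>j\<in>?NB. \<gamma> N bs s j * y $ j) / (denom s ?x * denom s ?base)"
    and pos: "0 < denom s ?x * denom s ?base" if s: "s \<in> {1, 2}" for s
  proof -
    let ?\<eta> = "\<Sum>j\<in>?NB. \<eta> N bs s j * y $ j" and ?\<theta> = "\<Sum>j\<in>?NB. \<theta> N bs s j * y $ j"
    have pos: "0 < denom s ?x" "0 < denom s ?base" using denom_pos[OF s] xX x0X by auto
    then show "0 < denom s ?x * denom s ?base" by simp
    have "(\<Sum>j\<in>?NB. \<gamma> N bs s j * y $ j) = denom s ?base * ?\<eta> - numer s ?base * ?\<theta>"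
      by (simp add: \<gamma>_def left_diff_distrib sum_subtractf sum_distrib_left mult.assoc)
    moreover have "numer s ?x = numer s ?base + ?\<eta>" "denom s ?x = denom s ?base + ?\<theta>"
      using linear_form_via_reduced_cost[OF shape bs p_dim[OF s] y]
        linear_form_via_reduced_cost[OF shape bs q_dim[OF s] y]
      by (simp_all add: numer_def denom_def \<eta>_def \<theta>_def)
    ultimately have "(\<Sum>j\<in>?NB. \<gamma> N bs s j * y $ j) = numer s ?x * denom s ?base - numer s ?base * denom s ?x"
      by (simp add: algebra_simps)
    then show "\<psi> s ?x - \<psi> s ?base = (\<Sum>j\<in>?NB. \<gamma> N bs s j * y $ j) / (denom s ?x * denom s ?base)"
      using pos by (simp add: \<psi>_def diff_frac_eq)
  qed
  have le: "\<psi> s ?base \<le> \<psi> s ?x" if s: "s \<in> {1, 2}" for s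
  proof -
    have "0 \<le> (\<Sum>j\<in>?NB. \<gamma> N bs s j * y $ j)" by (rule sum_nonneg) (rule terms[OF s])
    then have "0 \<le> \<psi> s ?x - \<psi> s ?base" unfolding diff[OF s] using pos[OF s] by simp
    then show ?thesis by simp
  qed
  obtain j where j: "j \<in> ?NB" "0 < y $ j" by (rule exists_positive_nonbasic[OF shape opt y ne])
  then have "j \<notin> H' N bs" using zero by fastforce
  then have "0 < \<gamma> N bs 1 j \<or> 0 < \<gamma> N bs 2 j"
    using j(1) opt1[OF j(1)] by (force simp: H'_def)
  then obtain s where s: "s \<in> {1, 2}" "0 < \<gamma> N bs s j" by blast
  have "0 < (\<Sum>j\<in>?NB. \<gamma> N bs s j * y $ j)"
    by (rule sum_pos2[OF _ j(1)]) (use s j terms in \<open>auto simp: nonbasic_def\<close>)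
  then have "0 < \<psi> s ?x - \<psi> s ?base" unfolding diff[OF s(1)] using pos[OF s(1)] by (rule divide_pos_pos)
  then have "\<psi> s ?base < \<psi> s ?x" by simp
  with le s(1) node_sol_in_D[OF N opt int] eff show False
    unfolding X_F_def efficient_set_def by blast
qed

end

section \<open>Termination and completeness\<close>

context blf_moiqp
begin

text \<open>The pair \<open>(k, i)\<close> stands for the open strip \<open>i < x $ k < i + 1\<close>, the region that branching on
  coordinate \<open>k\<close> removes.\<close>

definition cells :: "node \<Rightarrow> (nat \<times> int) set" where
  "cells N = {(k, i). k < n \<and> (\<exists>x\<in>node_poly N. of_int i < x $ k \<and> x $ k < of_int i + 1)}"

text \<open>Strictly smaller for every child: branching loses a strip, cutting loses an integral point.\<close>

definition work :: "node \<Rightarrow> nat" where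
  "work N = card (cells N) + card (node_poly N \<inter> D)"

lemma finite_cells:
  assumes "node_poly N \<subseteq> X"
  shows "finite (cells N)"
proof -
  obtain K where K: "\<And>x k. x \<in> X \<Longrightarrow> k < n \<Longrightarrow> \<bar>x $ k\<bar> \<le> K" using X_bounded by blast
  have "cells N \<subseteq> {..<n} \<times> {\<lfloor>- K - 1\<rfloor>..\<lceil>K\<rceil>}"
  proof
    fix z assume "z \<in> cells N"
    then obtain k i x where z: "z = (k, i)" "k < n" "x \<in> node_poly N" "of_int i < x $ k" "x $ k < of_int i + 1"
      by (auto simp: cells_def)
    have "\<bar>x $ k\<bar> \<le> K" using K z(2,3) assms by blast
    then have "of_int i \<le> K" "- K - 1 \<le> of_int i" using z(4,5) by linarith+
    then have "i \<le> \<lceil>K\<rceil>" "\<lfloor>- K - 1\<rfloor> \<le> i" by linarith+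
    then show "z \<in> {..<n} \<times> {\<lfloor>- K - 1\<rfloor>..\<lceil>K\<rceil>}" using z(1,2) by simp
  qed
  then show ?thesis by (rule finite_subset) simp
qed

lemma finite_D: "finite D"
proof -
  obtain K where K: "\<And>x k. x \<in> X \<Longrightarrow> k < n \<Longrightarrow> \<bar>x $ k\<bar> \<le> K" using X_bounded by blast
  let ?S = "real_of_int ` {\<lfloor>- K\<rfloor>..\<lceil>K\<rceil>}"
  have "D \<subseteq> vec_of_list ` {xs. set xs \<subseteq> ?S \<and> length xs = n}"
  proof
    fix x assume x: "x \<in> D"
    then have X: "x \<in> X" and c: "x \<in> carrier_vec n" by (auto simp: D_def X_def)
    have "x $ k \<in> ?S" if k: "k < n" for k
    proof -
      have "x $ k \<in> \<int>" using x k by (simp add: D_def)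
      then obtain z where z: "x $ k = of_int z" by (auto elim: Ints_cases)
      then have "\<lfloor>- K\<rfloor> \<le> z" "z \<le> \<lceil>K\<rceil>" using K[OF X k] by linarith+
      then show ?thesis using z by auto
    qed
    then have "set (list_of_vec x) \<subseteq> ?S" using c by (auto simp: set_list_of_vec vec_set_def)
    moreover have "length (list_of_vec x) = n" using c by simp
    moreover have "x = vec_of_list (list_of_vec x)" by (simp add: vec_list)
    ultimately show "x \<in> vec_of_list ` {xs. set xs \<subseteq> ?S \<and> length xs = n}" by blast
  qed
  then show ?thesis by (rule finite_subset) (simp add: finite_lists_length_eq)
qed

lemma cells_mono: "node_poly N' \<subseteq> node_poly N \<Longrightarrow> cells N' \<subseteq> cells N"
  by (auto simp: cells_def)

lemma work_less_if_cell_lost: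
  assumes X: "node_poly N \<subseteq> X" and sub: "node_poly N' \<subseteq> node_poly N"
    and "z \<in> cells N" "z \<notin> cells N'"
  shows "work N' < work N"
proof -
  have "card (cells N') < card (cells N)"
    using cells_mono[OF sub] assms(3,4) by (intro psubset_card_mono finite_cells[OF X]) blast
  moreover have "card (node_poly N' \<inter> D) \<le> card (node_poly N \<inter> D)"
    using sub finite_D by (intro card_mono) auto
  ultimately show ?thesis by (simp add: work_def)
qed

lemma work_less_if_point_lost:
  assumes X: "node_poly N \<subseteq> X" and sub: "node_poly N' \<subseteq> node_poly N"
    and "x \<in> node_poly N \<inter> D" "x \<notin> node_poly N'"
  shows "work N' < work N"
proof -
  have "card (cells N') \<le> card (cells N)"
    by (rule card_mono[OF finite_cells[OF X] cells_mono[OF sub]])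
  moreover have "card (node_poly N' \<inter> D) < card (node_poly N \<inter> D)"
    using sub assms(3,4) finite_D by (intro psubset_card_mono) auto
  ultimately show ?thesis by (simp add: work_def)
qed

lemma add_le_subset:
  assumes "node_shape n N"
  shows "node_poly (add_le N a d) \<subseteq> node_poly N"
  unfolding node_poly_add_le[OF assms] unfolding node_poly_def by blast

lemma add_ge_subset:
  assumes "node_shape n N"
  shows "node_poly (add_ge N a d) \<subseteq> node_poly N"
  unfolding node_poly_add_ge[OF assms] unfolding node_poly_def by blast

lemma branch_children:
  assumes N: "valid_node N" and opt: "optimal_tableau N bs" and k: "k < n" "node_sol N bs $ k \<notin> \<int>"
  defines "a \<equiv> \<lambda>j. if j = k then 1 else 0" and "v \<equiv> \<lfloor>node_sol N bs $ k\<rfloor>"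
  assumes N': "N' \<in> {add_le N a (of_int v), add_ge N a (of_int v + 1)}"
  shows "valid_node N'" and "work N' < work N"
proof -
  have shape: "node_shape n N" and X: "node_poly N \<subseteq> X" using N by (simp_all add: valid_node_def)
  have sum: "(\<Sum>j<dim_col (fst N). a j * y $ j) = y $ k" for y :: "real vec"
  proof -
    have "(\<Sum>j<dim_col (fst N). a j * y $ j) = (\<Sum>j<dim_col (fst N). if j = k then y $ j else 0)"
      by (rule sum.cong) (simp_all add: a_def)
    then show ?thesis using k(1) dim_col_ge[OF shape] by simp
  qed
  have "node_shape n N'"
    using N' by (auto simp: add_le_def add_ge_def a_def intro!: node_shape_add_row[OF shape])
  moreover have sub: "node_poly N' \<subseteq> node_poly N"
    using N' add_le_subset[OF shape] add_ge_subset[OF shape] by blast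
  ultimately show "valid_node N'" using X by (auto simp: valid_node_def)
  show "work N' < work N"
  proof (rule work_less_if_cell_lost[OF X sub])
    have "of_int v \<noteq> node_sol N bs $ k" using k(2) by (metis Ints_of_int)
    moreover have "of_int v \<le> node_sol N bs $ k" "node_sol N bs $ k < of_int v + 1"
      unfolding v_def by linarith+
    ultimately have "of_int v < node_sol N bs $ k" "node_sol N bs $ k < of_int v + 1" by simp_all
    then show "(k, v) \<in> cells N" using node_sol_in_node_poly[OF opt] k(1) by (auto simp: cells_def)
    have "x $ k \<le> of_int v \<or> of_int v + 1 \<le> x $ k" if "x \<in> node_poly N'" for x
      using that N' k(1)
      by (auto simp: node_poly_add_le[OF shape] node_poly_add_ge[OF shape] sum vec_first_def)
    then show "(k, v) \<notin> cells N'" by (force simp: cells_def)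
  qed
qed

lemma branch_keeps_integral_points:
  assumes N: "node_shape n N" and k: "k < n" and x: "x \<in> node_poly N" "x $ k \<in> \<int>"
  defines "a \<equiv> \<lambda>j. if j = k then 1 else 0"
  shows "x \<in> node_poly (add_le N a (of_int v)) \<union> node_poly (add_ge N a (of_int v + 1))"
proof -
  obtain y where y: "y \<in> ext_points N" "x = vec_first y n" using x(1) by (auto simp: node_poly_def)
  have "(\<Sum>j<dim_col (fst N). a j * y $ j) = (\<Sum>j<dim_col (fst N). if j = k then y $ j else 0)"
    by (rule sum.cong) (simp_all add: a_def)
  also have "\<dots> = x $ k" using k dim_col_ge[OF N] by (simp add: y(2) vec_first_def)
  finally have sum: "(\<Sum>j<dim_col (fst N). a j * y $ j) = x $ k" .
  obtain i where "x $ k = of_int i" using x(2) by (auto elim: Ints_cases)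
  moreover have "i \<le> v \<or> v + 1 \<le> i" by linarith
  then have "real_of_int i \<le> of_int v \<or> real_of_int (v + 1) \<le> of_int i"
    unfolding of_int_le_iff .
  ultimately have "x $ k \<le> of_int v \<or> of_int v + 1 \<le> x $ k" by simp
  then show ?thesis
    using y sum by (auto simp: node_poly_add_le[OF N] node_poly_add_ge[OF N])
qed

text \<open>The second cut ranges over variables of the node only, so its sum does not see the surplus
  variable of the first one.\<close>

lemma node_poly_two_cuts:
  assumes N: "node_shape n N" and J: "J \<subseteq> {..<dim_col (fst N)}" and J': "J' \<subseteq> {..<dim_col (fst N)}"
  shows "node_shape n (add_ge (add_ge N (\<lambda>j. if j \<in> J then 1 else 0) 1) (\<lambda>j. if j \<in> J' then 1 else 0) 1)"
    and "node_poly (add_ge (add_ge N (\<lambda>j. if j \<in> J then 1 else 0) 1) (\<lambda>j. if j \<in> J' then 1 else 0) 1) =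
      {vec_first y n | y. y \<in> ext_points N \<and> 1 \<le> (\<Sum>j\<in>J. y $ j) \<and> 1 \<le> (\<Sum>j\<in>J'. y $ j)}"
    (is "?P = ?R")
proof -
  let ?a = "\<lambda>J j. if j \<in> J then 1 else (0 :: real)"
  let ?N1 = "add_ge N (?a J) 1"
  have shape1: "node_shape n ?N1"
    unfolding add_ge_def by (rule node_shape_add_row[OF N]) auto
  show "node_shape n (add_ge ?N1 (?a J') 1)"
    unfolding add_ge_def[of ?N1] by (rule node_shape_add_row[OF shape1]) auto
  have dim1: "dim_col (fst ?N1) = Suc (dim_col (fst N))" by (simp add: add_ge_def add_row_dims)
  have sum: "(\<Sum>j<M. ?a I j * y $ j) = (\<Sum>j\<in>I. y $ j)" if "I \<subseteq> {..<M}" for I M and y :: "real vec"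
    using that by (intro sum.mono_neutral_cong_right) auto
  show "?P = ?R"
  proof (intro equalityI subsetI)
    fix x assume "x \<in> ?P"
    then obtain y' where y': "y' \<in> ext_points ?N1" "x = vec_first y' n" "1 \<le> (\<Sum>j<dim_col (fst ?N1). ?a J' j * y' $ j)"
      unfolding node_poly_add_ge[OF shape1] by blast
    obtain y z where y: "y' = y @\<^sub>v vec 1 (\<lambda>_. z)" "y \<in> ext_points N" "0 \<le> z"
      "(\<Sum>j<dim_col (fst N). ?a J j * y $ j) + - 1 * z = 1"
      by (rule ext_points_add_rowE[OF N y'(1)[unfolded add_ge_def]])
    have dy: "dim_vec y = dim_col (fst N)" using y(2) by (simp add: ext_points_iff)
    have "(\<Sum>j<dim_col (fst ?N1). ?a J' j * y' $ j) = (\<Sum>j\<in>J'. y' $ j)"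
      using J' dim1 by (intro sum) auto
    also have "\<dots> = (\<Sum>j\<in>J'. y $ j)" using J' dy by (intro sum.cong) (auto simp: y(1))
    finally have "1 \<le> (\<Sum>j\<in>J'. y $ j)" using y'(3) by simp
    moreover have "1 \<le> (\<Sum>j\<in>J. y $ j)" using y(3,4) sum[OF J, of y] by simp
    moreover have "x = vec_first y n"
      using dim_col_ge[OF N] dy unfolding y'(2) y(1) by (auto simp: vec_first_def vec_eq_iff)
    ultimately show "x \<in> ?R" using y(2) by blast
  next
    fix x assume "x \<in> ?R"
    then obtain y where y: "y \<in> ext_points N" "x = vec_first y n" "1 \<le> (\<Sum>j\<in>J. y $ j)" "1 \<le> (\<Sum>j\<in>J'. y $ j)"
      by blast
    let ?y' = "y @\<^sub>v vec 1 (\<lambda>_. (\<Sum>j\<in>J. y $ j) - 1)"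
    have dy: "dim_vec y = dim_col (fst N)" using y(1) by (simp add: ext_points_iff)
    have "?y' \<in> ext_points ?N1"
      unfolding add_ge_def by (rule ext_points_add_rowI[OF N y(1)]) (use y(3) sum[OF J, of y] in simp_all)
    moreover have "(\<Sum>j<dim_col (fst ?N1). ?a J' j * ?y' $ j) = (\<Sum>j\<in>J'. ?y' $ j)"
      using J' dim1 by (intro sum) auto
    moreover have "(\<Sum>j\<in>J'. ?y' $ j) = (\<Sum>j\<in>J'. y $ j)" using J' dy by (intro sum.cong) auto
    moreover have "x = vec_first ?y' n"
      using dim_col_ge[OF N] dy unfolding y(2) by (auto simp: vec_first_def vec_eq_iff)
    ultimately show "x \<in> ?P" unfolding node_poly_add_ge[OF shape1] using y(4) by auto
  qed
qed

abbreviation cut_node :: "node \<Rightarrow> nat list \<Rightarrow> node" where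
  "cut_node N bs \<equiv> add_ge (add_ge N (\<lambda>j. if j \<in> H N bs then 1 else 0) 1)
                             (\<lambda>j. if j \<in> H' N bs then 1 else 0) 1"

lemma H_subset: "H N bs \<subseteq> nonbasic (fst N) bs" and H'_subset: "H' N bs \<subseteq> nonbasic (fst N) bs"
  by (auto simp: H_def H'_def)

lemma nonbasic_subset: "nonbasic T bs \<subseteq> {..<dim_col T}"
  by (auto simp: nonbasic_def)

lemma node_poly_cut_node:
  assumes "node_shape n N"
  shows "node_poly (cut_node N bs) = {vec_first y n | y. y \<in> ext_points N \<and>
    1 \<le> (\<Sum>j\<in>H N bs. y $ j) \<and> 1 \<le> (\<Sum>j\<in>H' N bs. y $ j)}"
  by (rule node_poly_two_cuts(2)[OF assms order_trans[OF H_subset nonbasic_subset]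
    order_trans[OF H'_subset nonbasic_subset]])

lemma cut_child:
  assumes N: "valid_node N" and opt: "optimal_tableau N bs" and int: "integral (node_sol N bs)"
  shows "valid_node (cut_node N bs)" and "work (cut_node N bs) < work N"
proof -
  have shape: "node_shape n N" and X: "node_poly N \<subseteq> X" using N by (simp_all add: valid_node_def)
  have sub: "node_poly (cut_node N bs) \<subseteq> node_poly N"
    unfolding node_poly_cut_node[OF shape] by (auto simp: node_poly_def)
  have "node_shape n (cut_node N bs)"
    by (rule node_poly_two_cuts(1)[OF shape order_trans[OF H_subset nonbasic_subset]
      order_trans[OF H'_subset nonbasic_subset]])
  with sub X show "valid_node (cut_node N bs)" by (auto simp: valid_node_def)
  show "work (cut_node N bs) < work N"
  proof (rule work_less_if_point_lost[OF X sub])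
    show "node_sol N bs \<in> node_poly N \<inter> D"
      using node_sol_in_node_poly[OF opt] node_sol_in_D[OF N opt int] by blast
    show "node_sol N bs \<notin> node_poly (cut_node N bs)"
    proof
      assume "node_sol N bs \<in> node_poly (cut_node N bs)"
      then obtain y where y: "y \<in> ext_points N" "vec_first y n = node_sol N bs" "1 \<le> (\<Sum>j\<in>H N bs. y $ j)"
        unfolding node_poly_cut_node[OF shape] by auto
      have "y = basic_sol N bs" by (rule ext_point_of_node_sol[OF shape opt y(1,2)])
      then have "(\<Sum>j\<in>H N bs. y $ j) = 0"
        using H_subset[of N bs] by (intro sum.neutral) (auto simp: basic_sol_def nonbasic_def)
      with y(3) show False by simp
    qed
  qed
qed

text \<open>The slacks of a test point measure how much it improves on \<open>x\<close>. For the ratios this is seen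
  after multiplication by the positive denominators, which linearizes \<open>\<psi> s y \<le> \<psi> s x\<close>.\<close>

lemma passes_tests_if_efficient:
  assumes "x \<in> X_Q" "x \<in> X_F"
  shows "passes_tests x"
proof -
  have xD: "x \<in> D" and effQ: "\<And>y. y \<in> D \<Longrightarrow> \<forall>i\<in>{1..r}. f i y \<le> f i x \<Longrightarrow> \<forall>i\<in>{1..r}. f i x \<le> f i y"
    using assms(1) by (auto simp: X_Q_def efficient_set_def not_less)
  have effF: "\<And>y. y \<in> D \<Longrightarrow> \<forall>s\<in>{1, 2}. \<psi> s y \<le> \<psi> s x \<Longrightarrow> \<forall>s\<in>{1, 2}. \<psi> s x \<le> \<psi> s y"
    using assms(2) unfolding X_F_def efficient_set_def by (auto simp: not_less)
  have "is_max_value (T1_values x) 0"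
    unfolding is_max_value_def
  proof (intro conjI ballI)
    show "0 \<in> T1_values x"
      unfolding T1_values_def using xD by (intro CollectI exI[of _ "\<lambda>_. 0"] exI[of _ x]) simp
    fix w assume "w \<in> T1_values x"
    then obtain \<epsilon> y where w: "w = (\<Sum>i=1..r. \<epsilon> i)" and y: "y \<in> D"
      "\<forall>i\<in>{1..r}. f i y + \<epsilon> i \<le> f i x \<and> 0 \<le> \<epsilon> i" unfolding T1_values_def by blast
    have "\<forall>i\<in>{1..r}. f i y \<le> f i x" using y(2) by force
    from effQ[OF y(1) this] have "\<epsilon> i \<le> 0" if "i \<in> {1..r}" for i using y(2) that by force
    then show "w \<le> 0" unfolding w by (rule sum_nonpos)
  qed
  moreover have "is_max_value (T2_values x) 0"
    unfolding is_max_value_def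
  proof (intro conjI ballI)
    have form: "(p s - \<psi> s x \<cdot>\<^sub>v q s) \<bullet> y = numer s y - \<psi> s x * denom s y - (\<alpha> s - \<psi> s x * \<beta> s)"
      if s: "s \<in> {1, 2}" and y: "y \<in> carrier_vec n" for s y
    proof -
      have "(p s - \<psi> s x \<cdot>\<^sub>v q s) \<bullet> y = p s \<bullet> y - \<psi> s x * (q s \<bullet> y)"
        using p_dim[OF s] q_dim[OF s] y
        by (simp add: minus_scalar_prod_distrib[of _ n])
      then show ?thesis by (simp add: numer_def denom_def algebra_simps)
    qed
    have D: "y \<in> carrier_vec n" "y \<in> X" if "y \<in> D" for y using that by (auto simp: D_def X_def)
    have "numer s x = \<psi> s x * denom s x" if "s \<in> {1, 2}" for s
      using denom_pos[OF that D(2)[OF xD]] by (simp add: \<psi>_def)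
    then have "(p s - \<psi> s x \<cdot>\<^sub>v q s) \<bullet> x \<le> \<psi> s x * \<beta> s - \<alpha> s" if "s \<in> {1, 2}" for s
      using form[OF that D(1)[OF xD]] that by simp
    then show "0 \<in> T2_values x"
      unfolding T2_values_def using xD by (intro CollectI exI[of _ "\<lambda>_. 0"] exI[of _ x]) simp
    fix v assume "v \<in> T2_values x"
    then obtain w y where v: "v = w 1 + w 2" and y: "y \<in> D"
      "\<forall>s\<in>{1, 2}. (p s - \<psi> s x \<cdot>\<^sub>v q s) \<bullet> y + w s \<le> \<psi> s x * \<beta> s - \<alpha> s \<and> 0 \<le> w s"
      unfolding T2_values_def by blast
    have w: "numer s y - \<psi> s x * denom s y + w s \<le> 0" "0 \<le> w s" if s: "s \<in> {1, 2}" for s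
      using bspec[OF y(2) s] form[OF s D(1)[OF y(1)]] by auto
    have iff: "\<psi> s y \<le> \<psi> s x \<longleftrightarrow> numer s y \<le> \<psi> s x * denom s y"
      "\<psi> s x \<le> \<psi> s y \<longleftrightarrow> \<psi> s x * denom s y \<le> numer s y" if s: "s \<in> {1, 2}" for s
      using denom_pos[OF s D(2)[OF y(1)]] by (simp_all add: \<psi>_def[of s y] divide_le_eq le_divide_eq)
    have "\<forall>s\<in>{1, 2}. \<psi> s y \<le> \<psi> s x"
    proof
      fix s :: nat assume s: "s \<in> {1, 2}"
      show "\<psi> s y \<le> \<psi> s x" unfolding iff(1)[OF s] using w[OF s] by linarith
    qed
    note ge = effF[OF y(1) this]
    have "w s \<le> 0" if s: "s \<in> {1, 2}" for s
      using bspec[OF ge s] w(1)[OF s] unfolding iff(2)[OF s] by linarith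
    from this[of 1] this[of 2] show "v \<le> 0" unfolding v by simp
  qed
  ultimately show ?thesis by (simp add: passes_tests_def)
qed

lemma subset_update_Eff: "E \<subseteq> update_Eff E x"
  by (auto simp: update_Eff_def)

lemma solution_found_or_satisfies_cuts:
  assumes N: "valid_node N" and opt: "optimal_tableau N bs" and int: "integral (node_sol N bs)"
    and x: "x \<in> X_Q \<inter> X_F" "x \<in> node_poly N"
  shows "x \<in> update_Eff E (node_sol N bs)
    \<or> H N bs \<noteq> {} \<and> H' N bs \<noteq> {} \<and> x \<in> node_poly (cut_node N bs)"
proof (cases "x = node_sol N bs")
  case True
  then show ?thesis using x(1) passes_tests_if_efficient[of x] by (simp add: update_Eff_def)
next
  case False
  have shape: "node_shape n N" using N by (simp add: valid_node_def)
  obtain y where y: "y \<in> ext_points N" "x = vec_first y n" using x(2) by (auto simp: node_poly_def)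
  have "1 \<le> (\<Sum>j\<in>H N bs. y $ j)" "1 \<le> (\<Sum>j\<in>H' N bs. y $ j)"
    using efficient_satisfies_H_cut[OF N opt int y(1)] efficient_satisfies_H'_cut[OF N opt int y(1)]
      x(1) False y(2) by auto
  moreover from this have "H N bs \<noteq> {}" "H' N bs \<noteq> {}" by auto
  ultimately show ?thesis unfolding node_poly_cut_node[OF shape] using y by blast
qed

text \<open>All four kinds of iteration replace one node by children with less work, and no solution
  in the node is lost.\<close>

lemma bc_step_replaces_node:
  assumes "bc_step S S'" and valid: "\<forall>N\<in>#fst S. valid_node N"
  obtains N K where "N \<in># fst S" "fst S' = fst S - {#N#} + K" "snd S \<subseteq> snd S'"
    "\<forall>N'\<in>#K. valid_node N' \<and> work N' < work N"
    "\<forall>x \<in> X_Q \<inter> X_F \<inter> node_poly N. x \<in> snd S' \<or> (\<exists>N'\<in>#K. x \<in> node_poly N')"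
  using assms(1)
proof (cases rule: bc_step.cases)
  case (infeasible N L E)
  then show thesis by (intro that[of N "{#}"]) auto
next
  case (branch N L bs x k E)
  let ?a = "\<lambda>j. if j = k then 1 else (0 :: real)"
  let ?l = "add_le N ?a (of_int \<lfloor>x $ k\<rfloor>)" and ?g = "add_ge N ?a (of_int \<lfloor>x $ k\<rfloor> + 1)"
  have N: "valid_node N" using valid branch(1,3) by simp
  show thesis
  proof (rule that[of N "{#?l, ?g#}"])
    show "\<forall>N'\<in>#{#?l, ?g#}. valid_node N' \<and> work N' < work N"
    proof
      fix N' assume "N' \<in># {#?l, ?g#}"
      then have "N' \<in> {?l, ?g}" by auto
      then show "valid_node N' \<and> work N' < work N"
        using branch_children[OF N branch(4,6) branch(7)[unfolded branch(5)], folded branch(5)]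
        by blast
    qed
    show "\<forall>x \<in> X_Q \<inter> X_F \<inter> node_poly N. x \<in> snd S' \<or> (\<exists>N'\<in>#{#?l, ?g#}. x \<in> node_poly N')"
    proof
      fix z assume z: "z \<in> X_Q \<inter> X_F \<inter> node_poly N"
      have "z \<in> D" using z by (simp add: X_Q_def efficient_set_def)
      then have "z $ k \<in> \<int>" using branch(6) by (simp add: D_def)
      then have "z \<in> node_poly ?l \<union> node_poly ?g"
        using N z branch(6) by (intro branch_keeps_integral_points) (auto simp: valid_node_def)
      then show "z \<in> snd S' \<or> (\<exists>N'\<in>#{#?l, ?g#}. z \<in> node_poly N')" by auto
    qed
  qed (use branch in auto)
next
  case (fathom N L bs x E)
  have N: "valid_node N" using valid fathom(1,3) by simp
  show thesis
  proof (rule that[of N "{#}"])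
    show "\<forall>x \<in> X_Q \<inter> X_F \<inter> node_poly N. x \<in> snd S' \<or> (\<exists>N'\<in>#{#}. x \<in> node_poly N')"
    proof
      fix z assume "z \<in> X_Q \<inter> X_F \<inter> node_poly N"
      then have "z \<in> update_Eff E (node_sol N bs)"
        using solution_found_or_satisfies_cuts[OF N fathom(4) fathom(6)[unfolded fathom(5)], of z E]
          fathom(7) by blast
      then show "z \<in> snd S' \<or> (\<exists>N'\<in>#{#}. z \<in> node_poly N')" by (simp add: fathom(2,5))
    qed
  qed (use fathom subset_update_Eff in auto)
next
  case (cut N L bs x E)
  have N: "valid_node N" using valid cut(1,3) by simp
  show thesis
  proof (rule that[of N "{#cut_node N bs#}"])
    note int = cut(6)[unfolded cut(5)]
    show "\<forall>N'\<in>#{#cut_node N bs#}. valid_node N' \<and> work N' < work N"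
      using cut_child[OF N cut(4) int] by simp
    show "\<forall>x \<in> X_Q \<inter> X_F \<inter> node_poly N. x \<in> snd S' \<or> (\<exists>N'\<in>#{#cut_node N bs#}. x \<in> node_poly N')"
    proof
      fix z assume "z \<in> X_Q \<inter> X_F \<inter> node_poly N"
      then have "z \<in> update_Eff E (node_sol N bs) \<or> z \<in> node_poly (cut_node N bs)"
        using solution_found_or_satisfies_cuts[OF N cut(4) int, of z E] by blast
      then show "z \<in> snd S' \<or> (\<exists>N'\<in>#{#cut_node N bs#}. z \<in> node_poly N')" by (simp add: cut(2,5))
    qed
  qed (use cut subset_update_Eff in auto)
qed

definition sound_state :: "node multiset \<times> real vec set \<Rightarrow> bool" where
  "sound_state S \<longleftrightarrow> (\<forall>N\<in>#fst S. valid_node N) \<and>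
    (\<forall>x\<in>X_Q \<inter> X_F. x \<in> snd S \<or> (\<exists>N\<in>#fst S. x \<in> node_poly N))"

lemma sound_initial: "sound_state initial"
proof -
  have "x \<in> node_poly root" if "x \<in> X_Q" for x
    using that node_poly_root[OF A_dim b_dim] by (simp add: X_Q_def efficient_set_def D_def)
  then show ?thesis using root_valid by (simp add: sound_state_def initial_def)
qed

text \<open>Replacing one number in a multiset by any number of smaller ones decreases it in the multiset
  order, so the two children of a branching do no harm to termination.\<close>

lemma bc_step_sound:
  assumes "bc_step S S'" "sound_state S"
  shows "sound_state S'"
    and "(image_mset work (fst S'), image_mset work (fst S)) \<in> Multiset.mult less_than"
proof -
  have valid: "\<forall>N\<in>#fst S. valid_node N"
    and found: "\<forall>x\<in>X_Q \<inter> X_F. x \<in> snd S \<or> (\<exists>N\<in>#fst S. x \<in> node_poly N)"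
    using assms(2) by (simp_all add: sound_state_def)
  obtain N K where N: "N \<in># fst S" and S': "fst S' = fst S - {#N#} + K" and E: "snd S \<subseteq> snd S'"
    and K: "\<forall>N'\<in>#K. valid_node N' \<and> work N' < work N"
    and keep: "\<forall>x \<in> X_Q \<inter> X_F \<inter> node_poly N. x \<in> snd S' \<or> (\<exists>N'\<in>#K. x \<in> node_poly N')"
    by (rule bc_step_replaces_node[OF assms(1) valid])
  obtain L where L: "fst S = add_mset N L" using multi_member_split[OF N] by blast
  have S'_L: "fst S' = L + K" by (simp add: S' L)
  have "\<forall>N'\<in>#fst S'. valid_node N'" using valid K by (auto simp: S'_L L)
  moreover have "\<forall>x\<in>X_Q \<inter> X_F. x \<in> snd S' \<or> (\<exists>N\<in>#fst S'. x \<in> node_poly N)"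
  proof
    fix x assume x: "x \<in> X_Q \<inter> X_F"
    then have "x \<in> snd S \<or> x \<in> node_poly N \<or> (\<exists>N'\<in>#L. x \<in> node_poly N')"
      using bspec[OF found x] by (simp add: L)
    then consider "x \<in> snd S" | "x \<in> node_poly N" | N' where "N' \<in># L" "x \<in> node_poly N'"
      by blast
    then show "x \<in> snd S' \<or> (\<exists>N\<in>#fst S'. x \<in> node_poly N)"
    proof cases
      case 2
      then have "x \<in> snd S' \<or> (\<exists>N'\<in>#K. x \<in> node_poly N')" using keep x by blast
      then show ?thesis by (auto simp: S'_L)
    next
      case 3
      then show ?thesis by (auto simp: S'_L)
    qed (use E in blast)
  qed
  ultimately show "sound_state S'" by (simp add: sound_state_def)
  have "(image_mset work L + image_mset work K, image_mset work L + {#work N#}) \<in> Multiset.mult less_than"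
    by (rule one_step_implies_mult) (use K in auto)
  then show "(image_mset work (fst S'), image_mset work (fst S)) \<in> Multiset.mult less_than"
    by (simp add: S'_L L)
qed

lemma reachable_sound: "bc_step\<^sup>*\<^sup>* initial S \<Longrightarrow> sound_state S"
  by (induction rule: rtranclp_induct) (auto intro: sound_initial bc_step_sound(1))

lemma no_infinite_run: "\<not> (\<exists>\<sigma>. \<sigma> 0 = initial \<and> (\<forall>t. bc_step (\<sigma> t) (\<sigma> (Suc t))))"
proof
  assume "\<exists>\<sigma>. \<sigma> 0 = initial \<and> (\<forall>t. bc_step (\<sigma> t) (\<sigma> (Suc t)))"
  then obtain \<sigma> where \<sigma>: "\<sigma> 0 = initial" "\<And>t. bc_step (\<sigma> t) (\<sigma> (Suc t))" by blast
  have sound: "sound_state (\<sigma> t)" for t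
  proof (induction t)
    case (Suc t)
    then show ?case by (rule bc_step_sound(1)[OF \<sigma>(2)])
  qed (simp add: \<sigma>(1) sound_initial)
  have "(image_mset work (fst (\<sigma> (Suc t))), image_mset work (fst (\<sigma> t))) \<in> Multiset.mult less_than" for t
    by (rule bc_step_sound(2)[OF \<sigma>(2) sound])
  then have "\<exists>g. \<forall>t. (g (Suc t), g t) \<in> Multiset.mult less_than"
    by (intro exI[of _ "\<lambda>t. image_mset work (fst (\<sigma> t))"]) blast
  with wf_mult[OF wf_less_than] show False unfolding wf_iff_no_infinite_down_chain by blast
qed

lemma step_exists:
  assumes "sound_state (L, E)" "L \<noteq> {#}"
  shows "\<exists>S. bc_step (L, E) S"
proof -
  obtain N where N: "N \<in># L" using assms(2) by blast
  have valid: "valid_node N" using assms(1) N by (simp add: sound_state_def)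
  show ?thesis
  proof (cases "node_poly N = {}")
    case True
    then show ?thesis using bc_step.infeasible[OF N] by blast
  next
    case False
    then obtain bs where opt: "optimal_tableau N bs" using exists_optimal_tableau[OF valid] by blast
    show ?thesis
    proof (cases "integral (node_sol N bs)")
      case True
      then show ?thesis using bc_step.fathom[OF N opt refl] bc_step.cut[OF N opt refl] by blast
    next
      case False
      then show ?thesis using bc_step.branch[OF N opt refl] unfolding integral_def by blast
    qed
  qed
qed

lemma solutions_found:
  assumes "bc_step\<^sup>*\<^sup>* initial ({#}, E)"
  shows "X_Q \<inter> X_F \<subseteq> E"
  using reachable_sound[OF assms] by (auto simp: sound_state_def)

end

theorem theorem5:
  fixes n m r :: nat and A :: "int mat" and b :: "int vec"
    and Q :: "nat \<Rightarrow> int mat" and c :: "nat \<Rightarrow> int vec"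
    and p q :: "nat \<Rightarrow> real vec" and \<alpha> \<beta> :: "nat \<Rightarrow> real"
  assumes "blf_moiqp n m r A b Q c p q \<alpha> \<beta>"
  shows "\<not> (\<exists>\<sigma>. \<sigma> 0 = blf_data.initial n m A b
              \<and> (\<forall>t. blf_data.bc_step n r A b Q c p q \<alpha> \<beta> (\<sigma> t) (\<sigma> (Suc t))))
    \<and> (\<forall>L E. (blf_data.bc_step n r A b Q c p q \<alpha> \<beta>)\<^sup>*\<^sup>* (blf_data.initial n m A b) (L, E)
           \<and> L \<noteq> {#} \<longrightarrow> (\<exists>S. blf_data.bc_step n r A b Q c p q \<alpha> \<beta> (L, E) S))
    \<and> (\<forall>E. (blf_data.bc_step n r A b Q c p q \<alpha> \<beta>)\<^sup>*\<^sup>* (blf_data.initial n m A b) ({#}, E)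
           \<longrightarrow> blf_data.X_Q n r A b Q c \<inter> blf_data.X_F n A b p q \<alpha> \<beta> \<subseteq> E)"
proof -
  interpret blf_moiqp n m r A b Q c p q \<alpha> \<beta> by (fact assms)
  show ?thesis
    using no_infinite_run step_exists[OF reachable_sound] solutions_found by blast
qed

end
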